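(* Let $K$ be a field and consider a set of $s\ge4$ distinct skew lines $\mathcal L=\{L_1,\dots,L_s\}\subset\mathbb P^3_K$. Assume there is no smooth quadric containing all of the lines $L_i$ but that there are two distinct lines $T_1,T_2$ transversal to $\mathcal L$ and also defined over $K$. Then: (a) Each orbit under the action of $C_{\mathcal L}$ is one of the following: $T_1\cap(L_1\cup\cdots\cup L_s)$; $T_2\cap(L_1\cup\cdots\cup L_s)$; or $[p]$ for $p\in(L_1\cup\cdots\cup L_s)\setminus(T_1\cup T_2)$, in which case $|[p]|>s$, and, if $p,q\in(L_1\cup\cdots\cup L_s)\setminus(T_1\cup T_2)$, then $[p]$ and $[q]$ are projectively equivalent. (b) The group $G_i$ is (isomorphic to) a subgroup of the multiplicative group $K^*$, hence abelian, and, for $p\in L_i\setminus(T_1\cup T_2)$, the action of $C_{\mathcal L}$ on $[p]$ is faithful (i.e., only the identity of $G_i$ takes $p$ to itself). (c) Let $p\in L_i\setminus(T_1\cup T_2)$. If $[p]$ is finite, then $G_i$ is finite and cyclic. (d) Each group $G_i$ is generated by elements of the form $f_{jil}f_{ijk}$, hence $G_i$ is finite if and only if every element $f_{jil}f_{ijk}$ has finite order.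
   Context: For distinct $i,j,k$ let $f_{ijk}\colon L_i\to L_j$ be the linear isomorphism sending $p\in L_i$ to the point where the plane spanned by $p$ and $L_k$ meets $L_j$. The groupoid $C_{\mathcal L}$ has the lines $L_i$ as objects and all possible compositions of the maps $f_{ijk}$ as arrows. Put $G_i=\mathrm{Hom}_{C_{\mathcal L}}(L_i,L_i)$. For $p\in L_i$, its orbit is $[p]=\bigcup_j\{g(p):g\in\mathrm{Hom}_{C_{\mathcal L}}(L_i,L_j)\}$. A line is transversal to $\mathcal L$ if it meets every line of $\mathcal L$. Two subsets of $\mathbb P^3_K$ are projectively equivalent if an element of $PGL_4(K)$ takes one to the other. In $f_{jil}f_{ijk}$ the indices range over all values for which each map is defined (three distinct indices in each map). *)

theory Defs
  imports
    "HOL-Analysis.Cartesian_Space"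
    "HOL-Algebra.Algebraic_Closure_Type"
    "HOL-Algebra.Elementary_Groups"
    "HOL-Algebra.Generated_Groups"
    "HOL-Algebra.Multiplicative_Group"
begin

text \<open>
  A point of projective 3-space over \<open>'a\<close> is a 1-dimensional linear subspace of \<open>'a ^ 4\<close> and
  a line is a 2-dimensional one; the point set of a linear subspace \<open>V\<close> is \<open>pts V\<close>.
  Lines \<open>L\<^sub>1, \<dots>, L\<^sub>s\<close> are given by a function \<open>L\<close> on the index set \<open>{1..s}\<close>; the values
  of \<open>L\<close> outside this set are never used.
\<close>

definition pts :: "('a::field ^ 4) set \<Rightarrow> ('a ^ 4) set set" where
  "pts V = {p. vec.subspace p \<and> vec.dim p = 1 \<and> p \<subseteq> V}"

definition proj_line :: "('a::field ^ 4) set \<Rightarrow> bool" where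
  "proj_line V \<longleftrightarrow> vec.subspace V \<and> vec.dim V = 2"

definition all_pts :: "nat \<Rightarrow> (nat \<Rightarrow> ('a::field ^ 4) set) \<Rightarrow> ('a ^ 4) set set" where
  "all_pts s L = (\<Union>i\<in>{1..s}. pts (L i))"

definition skew_lines :: "nat \<Rightarrow> (nat \<Rightarrow> ('a::field ^ 4) set) \<Rightarrow> bool" where
  "skew_lines s L \<longleftrightarrow>
     (\<forall>i\<in>{1..s}. proj_line (L i)) \<and>
     (\<forall>i\<in>{1..s}. \<forall>j\<in>{1..s}. i \<noteq> j \<longrightarrow> pts (L i) \<inter> pts (L j) = {})"

definition transversal :: "nat \<Rightarrow> (nat \<Rightarrow> ('a::field ^ 4) set) \<Rightarrow> ('a ^ 4) set \<Rightarrow> bool" where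
  "transversal s L T \<longleftrightarrow> proj_line T \<and> (\<forall>i\<in>{1..s}. pts T \<inter> pts (L i) \<noteq> {})"

definition proj_equivalent :: "('a::field ^ 4) set set \<Rightarrow> ('a ^ 4) set set \<Rightarrow> bool" where
  "proj_equivalent S S' \<longleftrightarrow>
     (\<exists>A :: 'a ^ 4 ^ 4. invertible A \<and> (\<lambda>p. (*v) A ` p) ` S = S')"

text \<open>
  Every quadratic form is given by some (in general non-symmetric) coefficient matrix, in every
  characteristic. Its partial derivative with respect to \<open>x\<^sub>k\<close> is the \<open>k\<close>-th entry of
  \<open>quad_grad\<close>. Smoothness is the Jacobian criterion over the algebraic closure; the
  vanishing of the form at a singular point has to be demanded separately in characteristic 2.
  The zero form is not smooth.
\<close>

definition quad_form :: "'a::comm_ring_1 ^ 4 ^ 4 \<Rightarrow> 'a ^ 4 \<Rightarrow> 'a" where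
  "quad_form A x = (\<Sum>i\<in>UNIV. \<Sum>j\<in>UNIV. A $ i $ j * x $ i * x $ j)"

definition quad_grad :: "'a::comm_ring_1 ^ 4 ^ 4 \<Rightarrow> 'a ^ 4 \<Rightarrow> 'a ^ 4" where
  "quad_grad A x = (\<chi> k. \<Sum>j\<in>UNIV. (A $ k $ j + A $ j $ k) * x $ j)"

definition smooth_quadric :: "'a::field ^ 4 ^ 4 \<Rightarrow> bool" where
  "smooth_quadric A \<longleftrightarrow>
     (\<nexists>x :: 'a alg_closure ^ 4. x \<noteq> 0 \<and>
        quad_form (map_matrix to_ac A) x = 0 \<and> quad_grad (map_matrix to_ac A) x = 0)"

text \<open>
  Containment of a line is tested on rational points. This is enough over every field:
  a line has at least three rational points, and a binary quadratic form with three distinct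
  projective zeros is zero.
\<close>

definition quadric_pts :: "'a::field ^ 4 ^ 4 \<Rightarrow> ('a ^ 4) set set" where
  "quadric_pts A = {p \<in> pts UNIV. \<forall>x\<in>p. quad_form A x = 0}"

text \<open>
  The map \<open>f\<^sub>i\<^sub>j\<^sub>k\<close> on the points of \<open>L i\<close>: the plane spanned by \<open>p\<close> and \<open>L k\<close> is the linear
  span of their union, and its intersection with \<open>L j\<close> is again a 1-dimensional subspace.
  Arrows out of \<open>L i\<close> are extensional functions on \<open>pts (L i)\<close>, so that equality of functions
  is equality of arrows.
\<close>

definition fmap :: "(nat \<Rightarrow> ('a::field ^ 4) set) \<Rightarrow> nat \<Rightarrow> nat \<Rightarrow> nat \<Rightarrow> ('a ^ 4) set \<Rightarrow> ('a ^ 4) set"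
  where "fmap L i j k = (\<lambda>p\<in>pts (L i). vec.span (p \<union> L k) \<inter> L j)"

definition triple :: "nat \<Rightarrow> nat \<Rightarrow> nat \<Rightarrow> nat \<Rightarrow> bool" where
  "triple s i j k \<longleftrightarrow> i \<in> {1..s} \<and> j \<in> {1..s} \<and> k \<in> {1..s} \<and> i \<noteq> j \<and> i \<noteq> k \<and> j \<noteq> k"

inductive arrow :: "nat \<Rightarrow> (nat \<Rightarrow> ('a::field ^ 4) set) \<Rightarrow> nat \<Rightarrow> nat \<Rightarrow>
    (('a ^ 4) set \<Rightarrow> ('a ^ 4) set) \<Rightarrow> bool"
  for s L i where
    ident: "i \<in> {1..s} \<Longrightarrow> arrow s L i i (\<lambda>p\<in>pts (L i). p)"
  | step: "arrow s L i j g \<Longrightarrow> triple s j k l \<Longrightarrow>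
      arrow s L i k (compose (pts (L i)) (fmap L j k l) g)"

definition Homs :: "nat \<Rightarrow> (nat \<Rightarrow> ('a::field ^ 4) set) \<Rightarrow> nat \<Rightarrow> nat \<Rightarrow>
    (('a ^ 4) set \<Rightarrow> ('a ^ 4) set) set" where
  "Homs s L i j = {g. arrow s L i j g}"

definition vertex_group :: "nat \<Rightarrow> (nat \<Rightarrow> ('a::field ^ 4) set) \<Rightarrow> nat \<Rightarrow>
    (('a ^ 4) set \<Rightarrow> ('a ^ 4) set) monoid" where
  "vertex_group s L i =
     \<lparr>carrier = Homs s L i i, monoid.mult = compose (pts (L i)), monoid.one = (\<lambda>p\<in>pts (L i). p)\<rparr>"

text \<open>For skew lines the index \<open>i\<close> with \<open>p \<in> pts (L i)\<close> is unique.\<close>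

definition orbit :: "nat \<Rightarrow> (nat \<Rightarrow> ('a::field ^ 4) set) \<Rightarrow> ('a ^ 4) set \<Rightarrow> ('a ^ 4) set set" where
  "orbit s L p =
     (\<Union>i\<in>{i\<in>{1..s}. p \<in> pts (L i)}. \<Union>j\<in>{1..s}. {g p | g. g \<in> Homs s L i j})"

definition orbits :: "nat \<Rightarrow> (nat \<Rightarrow> ('a::field ^ 4) set) \<Rightarrow> ('a ^ 4) set set set" where
  "orbits s L = orbit s L ` all_pts s L"

definition loops :: "nat \<Rightarrow> (nat \<Rightarrow> ('a::field ^ 4) set) \<Rightarrow> nat \<Rightarrow>
    (('a ^ 4) set \<Rightarrow> ('a ^ 4) set) set" where
  "loops s L i =
     {compose (pts (L i)) (fmap L j i l) (fmap L i j k) | j k l. triple s i j k \<and> triple s j i l}"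

abbreviation mult_group :: "'a::field itself \<Rightarrow> 'a monoid" where
  "mult_group _ \<equiv> Multiplicative_Group.mult_of (ring_of_type_algebra :: 'a ring)"

end

theory Submission
  imports Defs
begin

text \<open>
  The two transversals are skew, so they split \<open>K\<^sup>4\<close> into two planes, and every \<open>L\<^sub>i\<close> is spanned by its
  points \<open>u\<^sub>i\<close> on \<open>T\<^sub>1\<close> and \<open>w\<^sub>i\<close> on \<open>T\<^sub>2\<close>. Let \<open>R\<^sub>i\<^sub>k = [w\<^sub>i, w\<^sub>k] / [u\<^sub>i, u\<^sub>k]\<close> be the quotient of the
  \<open>2 \<times> 2\<close> determinants of coordinates on \<open>T\<^sub>2\<close> and \<open>T\<^sub>1\<close>; it is nonzero and symmetric. Cramer's rule
  shows that \<open>f\<^sub>i\<^sub>j\<^sub>k\<close> sends \<open>a u\<^sub>i + b w\<^sub>i\<close> to \<open>a u\<^sub>j + (R\<^sub>i\<^sub>k / R\<^sub>j\<^sub>k) b w\<^sub>j\<close>. Every arrow is therefore a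
  scalar in \<open>K\<^sup>*\<close>, and composition is multiplication.

  If all the scalars \<open>R\<^sub>i\<^sub>k R\<^sub>j\<^sub>l / (R\<^sub>j\<^sub>k R\<^sub>i\<^sub>l)\<close> of the loops \<open>f\<^sub>j\<^sub>i\<^sub>l f\<^sub>i\<^sub>j\<^sub>k\<close> were \<open>1\<close>, the lines would lie in one
  ruling of a quadric \<open>y\<^sub>1 y\<^sub>4 = c y\<^sub>2 y\<^sub>3\<close>. Hence some loop moves every point off the transversals, which
  gives \<open>|[p]| > s\<close>. Scaling the second summand of \<open>K\<^sup>4\<close> commutes with the arrows and carries one orbit
  to another.
\<close>

no_notation fps_nth (infixl \<open>$\<close> 75)

section \<open>Finite subgroups of the multiplicative group of a field\<close>

text \<open>If \<open>(x \<otimes> y) [^] k = \<one>\<close>, multiplying the exponent by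
  \<open>ord y\<close> kills \<open>y\<close> and leaves a power of \<open>x\<close>, so
  \<open>ord x\<close> divides \<open>k * ord y\<close> and, by coprimality, \<open>k\<close>. The
  roles of \<open>x\<close> and \<open>y\<close> are symmetric.\<close>

lemma (in comm_group) ord_mult_coprime:
  assumes x: "x \<in> carrier G" and y: "y \<in> carrier G" and co: "coprime (ord x) (ord y)"
  shows "ord (x \<otimes> y) = ord x * ord y"
proof (rule dvd_antisym)
  show "ord (x \<otimes> y) dvd ord x * ord y"
    by (rule abelian_ord_mul_divides[OF x y])
  have *: "ord x dvd k" if "coprime (ord x) (ord y)" "(x \<otimes> y) [^] k = \<one>"
    and x: "x \<in> carrier G" and y: "y \<in> carrier G" for x y and k :: nat
  proof -
    have "(x \<otimes> y) [^] (k * ord y) = \<one>"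
      using that by (simp add: nat_pow_pow[symmetric])
    moreover have "y [^] (k * ord y) = \<one>"
      using y pow_eq_id by auto
    ultimately have "x [^] (k * ord y) = \<one>"
      using x y by (simp add: pow_mult_distrib m_comm)
    then have "ord x dvd k * ord y"
      using pow_eq_id[OF x] by simp
    then show ?thesis
      using that(1) by (simp add: coprime_dvd_mult_left_iff)
  qed
  have eq: "(x \<otimes> y) [^] ord (x \<otimes> y) = \<one>"
    using x y by simp
  have "ord x dvd ord (x \<otimes> y)"
    by (rule *[OF co eq x y])
  moreover have "ord y dvd ord (x \<otimes> y)"
    using *[of y x "ord (x \<otimes> y)"] co eq x y by (simp add: coprime_commute m_comm)
  ultimately show "ord x * ord y dvd ord (x \<otimes> y)"
    using co by (simp add: divides_mult)
qed

text \<open>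
  If a prime power \<open>p\<^sup>f\<close> divides the order of \<open>h\<close> but not that of \<open>g\<close>, replacing the \<open>p\<close>-part of \<open>g\<close> by
  that of \<open>h\<close> produces an element of larger order.
\<close>

lemma (in comm_group) ord_dvd_maximal_ord:
  assumes fin: "finite (carrier G)" and g: "g \<in> carrier G"
    and max: "\<And>x. x \<in> carrier G \<Longrightarrow> ord x \<le> ord g" and h: "h \<in> carrier G"
  shows "ord h dvd ord g"
proof (rule multiplicity_le_imp_dvd)
  have pos: "ord x > 0" if "x \<in> carrier G" for x
    using ord_ge_1[OF fin that] by simp
  show "ord h \<noteq> 0" using pos[OF h] by simp
  fix p :: nat assume p: "prime p"
  show "multiplicity p (ord h) \<le> multiplicity p (ord g)"
  proof (rule ccontr)
    assume less: "\<not> ?thesis"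
    define e f where "e = multiplicity p (ord g)" and "f = multiplicity p (ord h)"
    have nz: "ord g \<noteq> 0" "ord h \<noteq> 0" "\<not> is_unit p"
      using pos[OF g] pos[OF h] p by auto
    obtain n where n: "ord g = p ^ e * n" "\<not> p dvd n"
      unfolding e_def using multiplicity_decompose'[OF nz(1) nz(3)] by blast
    obtain m where m: "ord h = p ^ f * m" "\<not> p dvd m"
      unfolding f_def using multiplicity_decompose'[OF nz(2) nz(3)] by blast
    have p0: "p > 0" using p prime_gt_0_nat by simp
    have mn: "m > 0" "n > 0" using m(2) n(2) by (auto intro: Nat.gr0I)
    have og: "ord (g [^] (p ^ e)) = n"
      using ord_pow[OF g, of "p ^ e"] n p0 by simp
    have oh: "ord (h [^] m) = p ^ f"
      using ord_pow[OF h, of m] m mn by simp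
    have "coprime n (p ^ f)"
      using n(2) p by (metis coprime_commute coprime_power_left_iff prime_imp_coprime)
    then have "ord (g [^] (p ^ e) \<otimes> h [^] m) = n * p ^ f"
      using ord_mult_coprime[of "g [^] (p ^ e)" "h [^] m"] g h og oh by simp
    moreover have "p ^ f > p ^ e"
      using less prime_gt_1_nat[OF p] by (simp add: e_def f_def)
    then have "n * p ^ f > ord g"
      using mn by (subst n(1)) simp
    ultimately show False
      using max[of "g [^] (p ^ e) \<otimes> h [^] m"] g h by simp
  qed
qed

lemma finite_roots_of_unity:
  fixes n :: nat
  assumes "n > 0"
  shows "finite {x :: 'a :: field. x ^ n = 1}" and "card {x :: 'a. x ^ n = 1} \<le> n"
proof -
  define P where "P = monom (1 :: 'a) n - 1"
  have coeff: "poly.coeff P n = 1"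
    using assms by (simp add: P_def)
  have 0: "P \<noteq> 0" using coeff by auto
  have eq: "{x :: 'a. x ^ n = 1} = {x. poly P x = 0}"
    by (simp add: P_def poly_monom)
  have deg: "degree P \<le> n"
    by (auto simp: P_def intro!: degree_diff_le degree_monom_le)
  show "finite {x :: 'a. x ^ n = 1}"
    unfolding eq by (rule poly_roots_finite[OF 0])
  show "card {x :: 'a. x ^ n = 1} \<le> n"
    unfolding eq using card_poly_roots_bound[OF 0] deg by linarith
qed

lemma ring_of_type_algebra_simps [simp]:
  "carrier (ring_of_type_algebra :: 'a :: field ring) = UNIV"
  "x \<otimes>\<^bsub>ring_of_type_algebra\<^esub> y = (x * y :: 'a)"
  "\<one>\<^bsub>ring_of_type_algebra\<^esub> = (1 :: 'a)"
  "\<zero>\<^bsub>ring_of_type_algebra\<^esub> = (0 :: 'a)"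
  by (simp_all add: ring_of_type_algebra_def)

lemma mult_group_pow: "x [^]\<^bsub>mult_group TYPE('a :: field)\<^esub> (n :: nat) = x ^ n"
  by (induction n) (simp_all add: nat_pow_def mult.commute)

lemma comm_group_mult_group: "comm_group (mult_group TYPE('a :: field))"
proof -
  interpret group "mult_group TYPE('a)"
    by (rule field.field_mult_group) (rule field_from_type_algebra)
  show ?thesis
    by unfold_locales (simp_all add: mult.commute)
qed

text \<open>Let \<open>g\<close> have maximal order \<open>n\<close> in \<open>H\<close>. All orders
  divide \<open>n\<close>, so \<open>H\<close> consists of roots of \<open>X^n - 1\<close>, of which
  a field has at most \<open>n\<close>; the powers of \<open>g\<close> already are \<open>n\<close>
  elements.\<close>

lemma finite_subgroup_mult_group_cyclic:
  fixes H :: "'a :: field set"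
  assumes H: "subgroup H (mult_group TYPE('a))" and fin: "finite H"
  shows "cyclic_group ((mult_group TYPE('a))\<lparr>carrier := H\<rparr>)"
proof -
  interpret K: comm_group "mult_group TYPE('a)" by (rule comm_group_mult_group)
  define G where "G = (mult_group TYPE('a))\<lparr>carrier := H\<rparr>"
  interpret G: comm_group G
    unfolding G_def using K.subgroup_imp_group[OF H] by (rule group.group_comm_groupI) (simp add: mult.commute)
  have cG: "carrier G = H" by (simp add: G_def)
  have pow: "x [^]\<^bsub>G\<^esub> (n :: nat) = x ^ n" for x n
    using mult_group_pow[of x n] unfolding G_def
    by (metis K.nat_pow_consistent)
  have oneG: "\<one>\<^bsub>G\<^esub> = 1"
    by (simp add: G_def)
  have "G.ord ` H \<noteq> {}" "finite (G.ord ` H)"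
    using fin G.one_closed cG by auto
  then obtain g where g: "g \<in> H" and "G.ord g = Max (G.ord ` H)"
    by (metis Max_in imageE)
  then have max: "G.ord x \<le> G.ord g" if "x \<in> H" for x
    using that \<open>finite (G.ord ` H)\<close> by simp
  define n where "n = G.ord g"
  have n: "n > 0" using G.ord_ge_1[of g] fin g cG by (simp add: n_def)
  have sub: "H \<subseteq> {x. x ^ n = 1}"
  proof
    fix x assume x: "x \<in> H"
    have "G.ord x dvd n"
      unfolding n_def by (rule G.ord_dvd_maximal_ord) (use fin g max x cG in auto)
    then show "x \<in> {x. x ^ n = 1}"
      using G.pow_eq_id[of x n] x cG pow oneG by simp
  qed
  then have "card H \<le> n"
    using card_mono[OF finite_roots_of_unity(1)[OF n] sub] finite_roots_of_unity(2)[OF n, where 'a = 'a]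
    by linarith
  have "generate G {g} \<subseteq> H"
    using G.generate_incl[of "{g}"] g cG by simp
  moreover have "card (generate G {g}) = n"
    using G.generate_pow_card[of g] g cG by (simp add: n_def)
  ultimately have "generate G {g} = H"
    using \<open>card H \<le> n\<close> fin by (metis card_seteq)
  \<comment> \<open>\<open>subgroup_generated\<close> intersects its generators with the carrier;
    since \<open>g\<close> lies in \<open>H\<close>, this changes nothing.\<close>
  then have "G\<lparr>carrier := generate G (carrier G \<inter> {g})\<rparr> = G"
    using cG g by (simp add: Int_absorb1)
  then have "subgroup_generated G {g} = G"
    unfolding subgroup_generated_def by simp
  then show ?thesis
    unfolding cyclic_group_def G_def[symmetric] using g cG by blast
qed

section \<open>Skew lines with two skew transversals\<close>

lemma one_dim_span:
  assumes "vec.subspace (p :: ('a :: field ^ 'n) set)" "vec.dim p = 1"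
  obtains v where "v \<noteq> 0" "p = vec.span {v}"
proof -
  obtain B where B: "B \<subseteq> p" "vec.independent B" "p \<subseteq> vec.span B" "card B = 1"
    using vec.basis_exists[of p] assms(2) by metis
  then obtain v where v: "B = {v}" using card_1_singletonE by blast
  have "v \<noteq> 0" using B(2) v by auto
  moreover have "p = vec.span {v}"
    using B v assms(1) vec.span_minimal by blast
  ultimately show ?thesis using that by blast
qed

text \<open>Serves to push a collineation through an orbit that is given as a parametrized set of
  points.\<close>

lemma image_Collect2:
  assumes "\<And>k n. P k n \<Longrightarrow> F (f k n) = g k n"
  shows "F ` {f k n | k n. P k n} = {g k n | k n. P k n}"
proof (intro equalityI subsetI)
  fix x assume "x \<in> F ` {f k n | k n. P k n}"
  then obtain k n where "x = F (f k n)" "P k n" by blast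
  then show "x \<in> {g k n | k n. P k n}" using assms by blast
next
  fix x assume "x \<in> {g k n | k n. P k n}"
  then obtain k n where "x = g k n" "P k n" by blast
  then have "x = F (f k n)" "f k n \<in> {f k n | k n. P k n}" using assms by auto
  then show "x \<in> F ` {f k n | k n. P k n}" by blast
qed

text \<open>
  \<open>A i j\<close> and \<open>C i j\<close> stand for the \<open>2 \<times> 2\<close> determinants of the coordinates of \<open>u i, u j\<close> on \<open>T1\<close> and of
  \<open>w i, w j\<close> on \<open>T2\<close>.
\<close>

locale two_transversals =
  fixes s :: nat and L :: "nat \<Rightarrow> ('a :: field ^ 4) set" and T1 T2 :: "('a ^ 4) set"
    and u w :: "nat \<Rightarrow> 'a ^ 4" and A C :: "nat \<Rightarrow> nat \<Rightarrow> 'a"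
  assumes s4: "s \<ge> 4"
    and line_eq: "i \<in> {1..s} \<Longrightarrow> L i = {a *s u i + b *s w i | a b. True}"
    and indep: "i \<in> {1..s} \<Longrightarrow> j \<in> {1..s} \<Longrightarrow> i \<noteq> j \<Longrightarrow>
      a *s u i + b *s w i = c *s u j + d *s w j \<Longrightarrow> a = 0 \<and> b = 0 \<and> c = 0 \<and> d = 0"
    and T1_iff: "i \<in> {1..s} \<Longrightarrow> a *s u i + b *s w i \<in> T1 \<longleftrightarrow> b = 0"
    and T2_iff: "i \<in> {1..s} \<Longrightarrow> a *s u i + b *s w i \<in> T2 \<longleftrightarrow> a = 0"
    and subspace_T1: "vec.subspace T1" and subspace_T2: "vec.subspace T2"
    and A_nz: "i \<in> {1..s} \<Longrightarrow> j \<in> {1..s} \<Longrightarrow> i \<noteq> j \<Longrightarrow> A i j \<noteq> 0"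
    and C_nz: "i \<in> {1..s} \<Longrightarrow> j \<in> {1..s} \<Longrightarrow> i \<noteq> j \<Longrightarrow> C i j \<noteq> 0"
    and A_anti: "A i j = - A j i" and C_anti: "C i j = - C j i"
    and A_pluecker: "i \<in> {1..s} \<Longrightarrow> j \<in> {1..s} \<Longrightarrow> k \<in> {1..s} \<Longrightarrow>
      A j k *s u i = A i k *s u j + A j i *s u k"
    and C_pluecker: "i \<in> {1..s} \<Longrightarrow> j \<in> {1..s} \<Longrightarrow> k \<in> {1..s} \<Longrightarrow>
      C j k *s w i = C i k *s w j + C j i *s w k"
    and scaling: "c \<noteq> 0 \<Longrightarrow> \<exists>M :: 'a ^ 4 ^ 4. invertible M \<and>
      (\<forall>i\<in>{1..s}. M *v u i = u i \<and> M *v w i = c *s w i)"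
    and nondegenerate: "\<exists>i j k l. {i, j, k, l} \<subseteq> {1..s} \<and> distinct [i, j, k, l] \<and>
      C i k / A i k * (C j l / A j l) \<noteq> C i l / A i l * (C j k / A j k)"
begin

definition R :: "nat \<Rightarrow> nat \<Rightarrow> 'a" where "R i j = C i j / A i j"

text \<open>The point of \<open>L i\<close> with homogeneous coordinates (a : b). For a = b = 0 it
  is the zero subspace and not a point, hence the recurring side condition
  \<open>a \<noteq> 0 \<or> b \<noteq> 0\<close>.\<close>

definition pt :: "nat \<Rightarrow> 'a \<Rightarrow> 'a \<Rightarrow> ('a ^ 4) set" where
  "pt i a b = vec.span {a *s u i + b *s w i}"

text \<open>
  \<open>dil i j m\<close> is induced by the linear isomorphism \<open>L i \<rightarrow> L j\<close> with \<open>u i \<mapsto> u j\<close> and \<open>w i \<mapsto> m w j\<close>.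
\<close>

definition dil :: "nat \<Rightarrow> nat \<Rightarrow> 'a \<Rightarrow> ('a ^ 4) set \<Rightarrow> ('a ^ 4) set" where
  "dil i j m = (\<lambda>p\<in>pts (L i). {a *s u j + (m * b) *s w j | a b. a *s u i + b *s w i \<in> p})"

lemma R_sym: "R i j = R j i"
  unfolding R_def using A_anti[of i j] C_anti[of i j] by simp

lemma R_nz: "i \<in> {1..s} \<Longrightarrow> j \<in> {1..s} \<Longrightarrow> i \<noteq> j \<Longrightarrow> R i j \<noteq> 0"
  unfolding R_def using A_nz C_nz by simp

text \<open>Supplies auxiliary lines different from up to three given ones; avoiding three is where
  \<open>s \<ge> 4\<close> is used in full.\<close>

lemma fresh_index:
  assumes "card B < 4" "finite B"
  obtains k where "k \<in> {1..s}" "k \<notin> B"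
proof -
  have "\<not> {1..s} \<subseteq> B"
    using card_mono[of B "{1..s}"] assms s4 by auto
  then show ?thesis using that by blast
qed

text \<open>Independence is available only for two distinct lines, so the difference of the two
  sides is compared with the zero vector written on a second line.\<close>

lemma comb_inj:
  assumes i: "i \<in> {1..s}"
  shows "a *s u i + b *s w i = c *s u i + d *s w i \<longleftrightarrow> a = c \<and> b = d"
proof -
  have "a = c \<and> b = d" if eq: "a *s u i + b *s w i = c *s u i + d *s w i"
  proof -
    obtain j where j: "j \<in> {1..s}" "j \<notin> {i}"
      by (rule fresh_index[of "{i}"]) auto
    have "(a - c) *s u i + (b - d) *s w i = 0 *s u j + 0 *s w j"
      using eq by (simp add: algebra_simps vec.scale_left_diff_distrib)
    then show ?thesis using indep[OF i j(1)] j(2) by fastforce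
  qed
  then show ?thesis by auto
qed

lemma pt_iff: "v \<in> pt i a b \<longleftrightarrow> (\<exists>x. v = (x * a) *s u i + (x * b) *s w i)"
  unfolding pt_def vec.span_singleton
  by (auto simp: vec.scale_right_distrib)

lemma pt_iff_comb:
  assumes "i \<in> {1..s}"
  shows "c *s u i + d *s w i \<in> pt i a b \<longleftrightarrow> (\<exists>x. c = x * a \<and> d = x * b)"
  unfolding pt_iff comb_inj[OF assms] by simp

lemma pt_scale: "x \<noteq> 0 \<Longrightarrow> pt i (x * a) (x * b) = pt i a b"
proof (rule Set.set_eqI)
  fix v assume x: "x \<noteq> 0"
  show "v \<in> pt i (x * a) (x * b) \<longleftrightarrow> v \<in> pt i a b"
    unfolding pt_iff
  proof
    assume "\<exists>y. v = (y * (x * a)) *s u i + (y * (x * b)) *s w i"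
    then obtain y where "v = (y * (x * a)) *s u i + (y * (x * b)) *s w i" ..
    then show "\<exists>y. v = (y * a) *s u i + (y * b) *s w i"
      by (intro exI[of _ "y * x"]) (simp add: mult.assoc)
  next
    assume "\<exists>y. v = (y * a) *s u i + (y * b) *s w i"
    then obtain y where "v = (y * a) *s u i + (y * b) *s w i" ..
    then show "\<exists>y. v = (y * (x * a)) *s u i + (y * (x * b)) *s w i"
      using x by (intro exI[of _ "y / x"]) simp
  qed
qed

lemma pt_eqD:
  assumes i: "i \<in> {1..s}" and eq: "pt i a b = pt i c d" and "a \<noteq> 0" "b \<noteq> 0"
  shows "a * d = c * b"
proof -
  have "a *s u i + b *s w i \<in> pt i c d"
    unfolding eq[symmetric] pt_iff by (auto intro!: exI[of _ 1])
  then obtain x where "a = x * c" "b = x * d"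
    unfolding pt_iff_comb[OF i] by auto
  then show ?thesis by simp
qed

lemma comb_nz: "i \<in> {1..s} \<Longrightarrow> a *s u i + b *s w i = 0 \<longleftrightarrow> a = 0 \<and> b = 0"
  using comb_inj[of i a b 0 0] by simp

lemma pt_in_pts:
  assumes "i \<in> {1..s}" "a \<noteq> 0 \<or> b \<noteq> 0"
  shows "pt i a b \<in> pts (L i)"
proof -
  let ?v = "a *s u i + b *s w i"
  have "vec.dim (vec.span {?v}) = 1"
    using comb_nz[OF assms(1)] assms(2) vec.dim_span_eq_card_independent[of "{?v}"] by simp
  moreover have "pt i a b \<subseteq> L i"
    unfolding line_eq[OF assms(1)] using pt_iff by blast
  ultimately show ?thesis
    unfolding pts_def pt_def by auto
qed

lemma pts_E:
  assumes i: "i \<in> {1..s}" and p: "p \<in> pts (L i)"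
  obtains a b where "p = pt i a b" "a \<noteq> 0 \<or> b \<noteq> 0"
proof -
  obtain v where v: "v \<noteq> 0" "p = vec.span {v}"
    using p one_dim_span unfolding pts_def by blast
  have "v \<in> L i"
    using p v unfolding pts_def by (auto intro: vec.span_base)
  then obtain a b where "v = a *s u i + b *s w i"
    unfolding line_eq[OF i] by auto
  with v show ?thesis
    using that[of a b] comb_nz[OF i] unfolding pt_def by auto
qed

lemma pt_in_T1: "i \<in> {1..s} \<Longrightarrow> a \<noteq> 0 \<or> b \<noteq> 0 \<Longrightarrow> pt i a b \<in> pts T1 \<longleftrightarrow> b = 0"
  and pt_in_T2: "i \<in> {1..s} \<Longrightarrow> a \<noteq> 0 \<or> b \<noteq> 0 \<Longrightarrow> pt i a b \<in> pts T2 \<longleftrightarrow> a = 0"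
proof -
  assume i: "i \<in> {1..s}" and ab: "a \<noteq> 0 \<or> b \<noteq> 0"
  have 1: "vec.subspace (pt i a b)" "vec.dim (pt i a b) = 1"
    using pt_in_pts[OF i ab] unfolding pts_def by auto
  have 2: "pt i a b \<subseteq> T \<longleftrightarrow> a *s u i + b *s w i \<in> T" if "vec.subspace T" for T
    unfolding pt_def using vec.span_minimal[OF _ that] vec.span_base by blast
  show "pt i a b \<in> pts T1 \<longleftrightarrow> b = 0" "pt i a b \<in> pts T2 \<longleftrightarrow> a = 0"
    using 1 2[OF subspace_T1] 2[OF subspace_T2] T1_iff[OF i] T2_iff[OF i]
    unfolding pts_def by auto
qed

text \<open>Off the transversals both coordinates are nonzero, so the first can be normalized to 1
  and the point becomes a single scalar in K^*.\<close>

lemma pts_off_E: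
  assumes i: "i \<in> {1..s}" and p: "p \<in> pts (L i) - (pts T1 \<union> pts T2)"
  obtains b where "p = pt i 1 b" "b \<noteq> 0"
proof -
  obtain a b where ab: "p = pt i a b" "a \<noteq> 0 \<or> b \<noteq> 0" using pts_E[OF i] p by blast
  have "a \<noteq> 0" "b \<noteq> 0"
    using p ab pt_in_T1[OF i] pt_in_T2[OF i] by auto
  then show ?thesis
    using that[of "b / a"] ab(1) pt_scale[of a i 1 "b / a"] by simp
qed

lemma pt_off:
  assumes "i \<in> {1..s}" "b \<noteq> 0"
  shows "pt i 1 b \<in> pts (L i) - (pts T1 \<union> pts T2)"
  using assms pt_in_pts[of i 1 b] pt_in_T1[of i 1 b] pt_in_T2[of i 1 b] by auto

lemma pts_disjoint:
  assumes "i \<in> {1..s}" "j \<in> {1..s}" "p \<in> pts (L i)" "p \<in> pts (L j)"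
  shows "i = j"
proof (rule ccontr)
  assume ij: "i \<noteq> j"
  obtain a b where ab: "p = pt i a b" "a \<noteq> 0 \<or> b \<noteq> 0" using pts_E assms by blast
  obtain c d where cd: "p = pt j c d" using pts_E assms by blast
  have "a *s u i + b *s w i \<in> pt i a b" unfolding pt_iff by (auto intro!: exI[of _ 1])
  then obtain x where "a *s u i + b *s w i = (x * c) *s u j + (x * d) *s w j"
    using ab(1) cd pt_iff by metis
  then show False using indep[OF assms(1,2) ij] ab(2) by blast
qed

section \<open>Maps between the lines in homogeneous coordinates\<close>

lemma dil_pt:
  assumes i: "i \<in> {1..s}" and ab: "a \<noteq> 0 \<or> b \<noteq> 0"
  shows "dil i j m (pt i a b) = pt j a (m * b)"
proof -
  have "dil i j m (pt i a b) = {c *s u j + (m * d) *s w j | c d. \<exists>x. c = x * a \<and> d = x * b}"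
    unfolding dil_def using pt_in_pts[OF assms] pt_iff_comb[OF i] by simp
  also have "\<dots> = pt j a (m * b)"
  proof (rule Set.set_eqI)
    fix v
    have "v \<in> {c *s u j + (m * d) *s w j | c d. \<exists>x. c = x * a \<and> d = x * b}
      \<longleftrightarrow> (\<exists>x. v = (x * a) *s u j + (m * (x * b)) *s w j)"
      by auto
    then show "v \<in> {c *s u j + (m * d) *s w j | c d. \<exists>x. c = x * a \<and> d = x * b}
      \<longleftrightarrow> v \<in> pt j a (m * b)"
      unfolding pt_iff by (simp add: mult.left_commute)
  qed
  finally show ?thesis .
qed

lemma dil_in_pts:
  assumes "i \<in> {1..s}" "j \<in> {1..s}" "m \<noteq> 0" "p \<in> pts (L i)"
  shows "dil i j m p \<in> pts (L j)"
proof -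
  obtain a b where "p = pt i a b" "a \<noteq> 0 \<or> b \<noteq> 0" using pts_E assms by blast
  then show ?thesis using assms by (simp add: dil_pt pt_in_pts)
qed

lemma dil_compose:
  assumes "i \<in> {1..s}" "j \<in> {1..s}" "m \<noteq> 0"
  shows "compose (pts (L i)) (dil j k n) (dil i j m) = dil i k (m * n)"
proof (rule extensionalityI)
  show "compose (pts (L i)) (dil j k n) (dil i j m) \<in> extensional (pts (L i))" by simp
  show "dil i k (m * n) \<in> extensional (pts (L i))" by (simp add: dil_def)
  fix p assume p: "p \<in> pts (L i)"
  then obtain a b where ab: "p = pt i a b" "a \<noteq> 0 \<or> b \<noteq> 0" using pts_E assms by blast
  then show "compose (pts (L i)) (dil j k n) (dil i j m) p = dil i k (m * n) p"
    using p assms by (simp add: compose_eq dil_pt ac_simps)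
qed

lemma dil_one: "i \<in> {1..s} \<Longrightarrow> dil i i 1 = (\<lambda>p\<in>pts (L i). p)"
proof (rule extensionalityI)
  assume i: "i \<in> {1..s}"
  fix p assume p: "p \<in> pts (L i)"
  then obtain a b where ab: "p = pt i a b" "a \<noteq> 0 \<or> b \<noteq> 0" using pts_E i by blast
  then show "dil i i 1 p = (\<lambda>p\<in>pts (L i). p) p"
    using p i by (simp add: dil_pt)
qed (simp_all add: dil_def)

text \<open>One point off the transversals determines the scalar. This yields faithfulness, the
  injectivity of \<open>dil i j\<close> on nonzero scalars, and the count of points in
  orbits.\<close>

lemma dil_pt_eqD:
  assumes "i \<in> {1..s}" "j \<in> {1..s}" "m \<noteq> 0" "p \<in> pts (L i) - (pts T1 \<union> pts T2)"
    and "dil i j m p = dil i j n p"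
  shows "m = n"
proof -
  obtain b where b: "p = pt i 1 b" "b \<noteq> 0" using pts_off_E assms by blast
  then have "pt j 1 (m * b) = pt j 1 (n * b)"
    using assms by (simp add: dil_pt)
  then have "1 * (n * b) = 1 * (m * b)"
    using pt_eqD[of j 1 "m * b" 1 "n * b"] assms b by simp
  then show ?thesis using b by simp
qed

lemma dil_inj:
  assumes "i \<in> {1..s}" "j \<in> {1..s}" "m \<noteq> 0" "dil i j m = dil i j n"
  shows "m = n"
  using dil_pt_eqD[OF assms(1-3) pt_off[OF assms(1), of 1]] assms(4) by simp

text \<open>Modulo \<open>L k\<close>, the vectors \<open>u i\<close> and \<open>w i\<close> are
  multiples of \<open>u j\<close> and \<open>w j\<close> by the Pluecker relations, so projecting
  from \<open>L k\<close> is diagonal in these bases. Only the quotient of the two multiples matters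
  projectively.\<close>

lemma fmap_eq_dil:
  assumes t: "triple s i j k"
  shows "fmap L i j k = dil i j (R i k / R j k)"
proof (rule extensionalityI)
  show "fmap L i j k \<in> extensional (pts (L i))" "dil i j (R i k / R j k) \<in> extensional (pts (L i))"
    by (simp_all add: fmap_def dil_def)
  fix p assume p: "p \<in> pts (L i)"
  have ijk: "i \<in> {1..s}" "j \<in> {1..s}" "k \<in> {1..s}" "i \<noteq> j" "i \<noteq> k" "j \<noteq> k"
    using t unfolding triple_def by auto
  obtain a b where ab: "p = pt i a b" "a \<noteq> 0 \<or> b \<noteq> 0" using pts_E[OF ijk(1) p] .
  \<comment> \<open>Coordinates of \<open>u i\<close> with respect to \<open>u j\<close>,
    \<open>u k\<close>, and of \<open>w i\<close> with respect to \<open>w j\<close>,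
    \<open>w k\<close>.\<close>
  define xu xw yu yw where "xu = A i k / A j k" and "xw = C i k / C j k"
    and "yu = A j i / A j k" and "yw = C j i / C j k"
  have nz: "A i k \<noteq> 0" "A j k \<noteq> 0" "C i k \<noteq> 0" "C j k \<noteq> 0" using A_nz C_nz ijk by auto
  have ui: "u i = xu *s u j + yu *s u k"
    using arg_cong[OF A_pluecker[OF ijk(1-3)], of "\<lambda>v. (1 / A j k) *s v"] nz
    by (simp add: xu_def yu_def vec.scale_right_distrib)
  have wi: "w i = xw *s w j + yw *s w k"
    using arg_cong[OF C_pluecker[OF ijk(1-3)], of "\<lambda>v. (1 / C j k) *s v"] nz
    by (simp add: xw_def yw_def vec.scale_right_distrib)
  have xx: "xu \<noteq> 0" "xw / xu = R i k / R j k"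
    using nz by (simp_all add: xu_def xw_def R_def field_simps)
  have subL: "vec.subspace (L k)"
    unfolding line_eq[OF ijk(3)]
  proof (rule vec.subspaceI; clarsimp)
    show "\<exists>a b. a *s u k + b *s w k = 0" by (intro exI[of _ 0]) simp
    fix a b a' b'
    show "\<exists>aa bb. a *s u k + b *s w k + (a' *s u k + b' *s w k) = aa *s u k + bb *s w k"
      by (intro exI[of _ "a + a'"] exI[of _ "b + b'"]) (simp add: vec.scale_left_distrib)
  next
    fix c a b
    show "\<exists>aa bb. c *s (a *s u k + b *s w k) = aa *s u k + bb *s w k"
      by (intro exI[of _ "c * a"] exI[of _ "c * b"]) (simp add: vec.scale_right_distrib)
  qed
  have span: "vec.span (p \<union> L k) = {x + y | x y. x \<in> p \<and> y \<in> L k}"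
    using subL p unfolding vec.span_Un pts_def by (simp add: vec.span_eq_iff[THEN iffD2])
  have mem: "v \<in> vec.span (p \<union> L k) \<longleftrightarrow>
    (\<exists>x c d. v = (x * a) *s u i + (x * b) *s w i + (c *s u k + d *s w k))" for v
  proof -
    have "v \<in> vec.span (p \<union> L k) \<longleftrightarrow> (\<exists>x y. v = x + y \<and> x \<in> pt i a b \<and> y \<in> L k)"
      unfolding span ab(1)[symmetric] by blast
    then show ?thesis
      unfolding pt_iff line_eq[OF ijk(3)] by blast
  qed
  have "v \<in> vec.span (p \<union> L k) \<inter> L j \<longleftrightarrow> v \<in> pt j (a * xu) (b * xw)" for v
  proof
    assume v: "v \<in> vec.span (p \<union> L k) \<inter> L j"
    then obtain x c d e f where
      v1: "v = (x * a) *s u i + (x * b) *s w i + (c *s u k + d *s w k)"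
      and v2: "v = e *s u j + f *s w j"
      using mem line_eq[OF ijk(2)] by blast
    \<comment> \<open>Equating the two expressions for \<open>v\<close> and separating the parts in
      \<open>L j\<close> and \<open>L k\<close>; skewness makes both sides vanish, which determines
      \<open>e\<close> and \<open>f\<close>.\<close>
    have "(x * a * xu - e) *s u j + (x * b * xw - f) *s w j
      = (- (x * a * yu + c)) *s u k + (- (x * b * yw + d)) *s w k"
      using v1 v2 unfolding ui wi
      by (simp add: vec.scale_left_distrib vec.scale_right_distrib vec.scale_left_diff_distrib algebra_simps)
    from indep[OF ijk(2,3,6) this] show "v \<in> pt j (a * xu) (b * xw)"
      unfolding v2 pt_iff by (auto intro!: exI[of _ x] simp: ac_simps)
  next
    assume "v \<in> pt j (a * xu) (b * xw)"
    then obtain x where v: "v = (x * (a * xu)) *s u j + (x * (b * xw)) *s w j"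
      unfolding pt_iff by auto
    have "v = ((x * a) *s u i + (x * b) *s w i) + ((- (x * a * yu)) *s u k + (- (x * b * yw)) *s w k)"
      unfolding v ui wi by (simp add: vec.scale_right_distrib algebra_simps)
    then have "v \<in> vec.span (p \<union> L k)"
      unfolding mem by blast
    then show "v \<in> vec.span (p \<union> L k) \<inter> L j"
      unfolding line_eq[OF ijk(2)] using v by auto
  qed
  then have "fmap L i j k p = pt j (a * xu) (b * xw)"
    using p unfolding fmap_def by auto
  \<comment> \<open>Pulling out the common factor \<open>xu\<close> restores the first coordinate
    \<open>a\<close>.\<close>
  also have "\<dots> = pt j (xu * a) (xu * (R i k / R j k * b))"
    unfolding xx(2)[symmetric] using xx(1) by (simp add: ac_simps)
  also have "\<dots> = dil i j (R i k / R j k) p"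
    unfolding pt_scale[OF xx(1)] ab(1) dil_pt[OF ijk(1) ab(2)] ..
  finally show "fmap L i j k p = dil i j (R i k / R j k) p" .
qed

section \<open>Arrows as scalars\<close>

lemma tripleD:
  assumes "triple s i j k"
  shows "i \<in> {1..s}" "j \<in> {1..s}" "k \<in> {1..s}" "i \<noteq> j" "i \<noteq> k" "j \<noteq> k"
  using assms unfolding triple_def by auto

lemma cross_nz:
  assumes "triple s i j k"
  shows "R i k / R j k \<noteq> 0"
  using tripleD[OF assms] R_nz[of i k] R_nz[of j k] by simp

lemma arrow_one: "i \<in> {1..s} \<Longrightarrow> arrow s L i i (dil i i 1)"
  using arrow.ident[of i s L] dil_one[of i] by simp

text \<open>Arrows grow at their target, so closure under composition is proved by induction on the
  second arrow \<open>h\<close>, with an arbitrary first arrow \<open>dil i j m\<close> carried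
  along in the claim.\<close>

lemma arrow_transitive:
  assumes "arrow s L j k h"
  shows "\<exists>n. n \<noteq> 0 \<and> k \<in> {1..s} \<and> h = dil j k n \<and>
    (\<forall>i m. i \<in> {1..s} \<longrightarrow> m \<noteq> 0 \<longrightarrow> arrow s L i j (dil i j m) \<longrightarrow> arrow s L i k (dil i k (m * n)))"
  using assms
proof induction
  case ident
  then show ?case using dil_one[of j] by (intro exI[of _ 1]) auto
next
  case (step k g k' l)
  then obtain n where n: "n \<noteq> 0" "k \<in> {1..s}" "g = dil j k n"
    and tr: "\<And>i m. i \<in> {1..s} \<Longrightarrow> m \<noteq> 0 \<Longrightarrow> arrow s L i j (dil i j m) \<Longrightarrow> arrow s L i k (dil i k (m * n))"
    by blast
  have j: "j \<in> {1..s}"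
    using step(1) by (induction) auto
  note f = fmap_eq_dil[OF step(2)]
  let ?r = "R k l / R k' l"
  have r: "?r \<noteq> 0" by (rule cross_nz[OF step(2)])
  have "arrow s L i k' (dil i k' (m * (n * ?r)))"
    if "i \<in> {1..s}" "m \<noteq> 0" "arrow s L i j (dil i j m)" for i m
    using arrow.step[OF tr[OF that] step(2)] that n
    by (simp add: f dil_compose mult.assoc)
  then show ?case
    using n r j tripleD[OF step(2)] unfolding f n(3)
    by (intro exI[of _ "n * ?r"]) (simp add: dil_compose)
qed

lemma arrow_source: "arrow s L i j g \<Longrightarrow> i \<in> {1..s}"
  by (induction rule: arrow.induct) auto

lemma arrow_dil:
  assumes "arrow s L i j g"
  obtains m where "m \<noteq> 0" "g = dil i j m" "i \<in> {1..s}" "j \<in> {1..s}"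
  using arrow_transitive[OF assms] arrow_source[OF assms] by blast

lemma arrow_trans:
  assumes "arrow s L i j (dil i j m)" "arrow s L j k (dil j k n)" "m \<noteq> 0" "n \<noteq> 0"
  shows "arrow s L i k (dil i k (m * n))"
proof -
  note ij = arrow_source[OF assms(1)] arrow_source[OF assms(2)]
  obtain n' where n': "k \<in> {1..s}" "dil j k n = dil j k n'"
    and *: "arrow s L i k (dil i k (m * n'))"
    using arrow_transitive[OF assms(2)] assms ij by metis
  \<comment> \<open>The scalar delivered by \<open>arrow_transitive\<close> is existential;
    injectivity identifies it with \<open>n\<close>.\<close>
  have "n = n'" using dil_inj[OF ij(2) n'(1) assms(4) n'(2)] .
  then show ?thesis using * by simp
qed

lemma arrow_triple:
  assumes "triple s i j k"
  shows "arrow s L i j (dil i j (R i k / R j k))"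
proof -
  note t = tripleD[OF assms]
  from arrow.step[OF arrow_one[OF t(1)] assms] show ?thesis
    using t by (simp add: fmap_eq_dil[OF assms] dil_compose)
qed

lemma triple_swap: "triple s i j k \<Longrightarrow> triple s j i k"
  unfolding triple_def by auto

text \<open>The inverse of \<open>fmap L j k l\<close> is \<open>fmap L k j l\<close>, whose scalar
  is the reciprocal; an arrow is inverted step by step in reverse order.\<close>

lemma arrow_inverse:
  assumes "arrow s L i j g"
  shows "\<exists>m. m \<noteq> 0 \<and> g = dil i j m \<and> arrow s L j i (dil j i (inverse m))"
  using assms
proof induction
  case ident
  then show ?case using dil_one[OF ident] arrow_one[OF ident]
    by (intro exI[of _ 1]) (simp del: atLeastAtMost_iff restrict_apply)
next
  case (step j g k l)
  then obtain m where m: "m \<noteq> 0" "g = dil i j m" "arrow s L j i (dil j i (inverse m))" by blast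
  note ij = arrow_source[OF step(1)] arrow_source[OF m(3)]
  let ?r = "R j l / R k l"
  have r: "?r \<noteq> 0" by (rule cross_nz[OF step(2)])
  have "arrow s L k j (dil k j (inverse ?r))"
    using arrow_triple[OF triple_swap[OF step(2)]] by simp
  from arrow_trans[OF this m(3)] m(1) r
  have "arrow s L k i (dil k i (inverse (m * ?r)))"
    by (simp add: field_simps)
  then show ?case
    using m(1) r dil_compose[OF ij m(1), of k ?r]
    by (intro exI[of _ "m * ?r"]) (simp add: fmap_eq_dil[OF step(2)] m(2))
qed

lemma arrow_exists:
  assumes "i \<in> {1..s}" "j \<in> {1..s}"
  obtains m where "m \<noteq> 0" "arrow s L i j (dil i j m)"
proof (cases "i = j")
  case True
  then show ?thesis using that[of 1] arrow_one[OF assms(1)] by simp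
next
  case False
  obtain k where "k \<in> {1..s}" "k \<notin> {i, j}"
    by (rule fresh_index[of "{i, j}"]) (auto simp: card_insert_if)
  then have "triple s i j k" using False assms unfolding triple_def by auto
  then show ?thesis using that arrow_triple cross_nz by blast
qed

section \<open>Scalars of the loops and the group they generate\<close>

definition loop_labels :: "nat \<Rightarrow> 'a set" where
  "loop_labels i = {R i k / R j k * (R j l / R i l) | j k l. triple s i j k \<and> triple s j i l}"

text \<open>Turns out to be the vertex group at \<open>i\<close>, read as scalars. For
  \<open>i\<close> outside the index range \<open>loop_labels i\<close> is empty, so this is still a
  (trivial) subgroup.\<close>

definition labels :: "nat \<Rightarrow> 'a set" where
  "labels i = generate (mult_group TYPE('a)) (loop_labels i)"

lemma loop_labelsI: "triple s i j k \<Longrightarrow> triple s j i l \<Longrightarrow> R i k / R j k * (R j l / R i l) \<in> loop_labels i"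
  unfolding loop_labels_def by blast

lemma loop_labels_nz: "x \<in> loop_labels i \<Longrightarrow> x \<noteq> 0"
  unfolding loop_labels_def using cross_nz by fastforce

text \<open>The inverse of \<open>f\<^sub>j\<^sub>i\<^sub>l f\<^sub>i\<^sub>j\<^sub>k\<close> is
  \<open>f\<^sub>j\<^sub>i\<^sub>k f\<^sub>i\<^sub>j\<^sub>l\<close>, again a loop of the same
  shape.\<close>

lemma loop_labels_inverse: "x \<in> loop_labels i \<Longrightarrow> inverse x \<in> loop_labels i"
proof -
  assume "x \<in> loop_labels i"
  then obtain j k l where x: "x = R i k / R j k * (R j l / R i l)"
    and t: "triple s i j k" "triple s j i l" unfolding loop_labels_def by blast
  have "inverse x = R i l / R j l * (R j k / R i k)" unfolding x by (simp add: mult.commute)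
  then show ?thesis using loop_labelsI[OF triple_swap[OF t(2)] triple_swap[OF t(1)]] by simp
qed

text \<open>Makes a common exponent possible when every loop has finite order.\<close>

lemma finite_loop_labels: "finite (loop_labels i)"
proof -
  have "loop_labels i \<subseteq> (\<lambda>(j, k, l). R i k / R j k * (R j l / R i l)) ` ({1..s} \<times> {1..s} \<times> {1..s})"
  proof
    fix x assume "x \<in> loop_labels i"
    then obtain j k l where x: "x = R i k / R j k * (R j l / R i l)"
      and t: "triple s i j k" "triple s j i l" unfolding loop_labels_def by blast
    show "x \<in> (\<lambda>(j, k, l). R i k / R j k * (R j l / R i l)) ` ({1..s} \<times> {1..s} \<times> {1..s})"
      using x tripleD[OF t(1)] tripleD[OF t(2)] by (intro image_eqI[of _ _ "(j, k, l)"]) auto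
  qed
  then show ?thesis by (rule finite_subset) simp
qed

sublocale K: comm_group "mult_group TYPE('a)"
  by (rule comm_group_mult_group)

lemma subgroup_labels: "subgroup (labels i) (mult_group TYPE('a))"
  unfolding labels_def by (rule K.generate_is_subgroup) (use loop_labels_nz in auto)

lemma labels_nz: "x \<in> labels i \<Longrightarrow> x \<noteq> 0"
  using K.subgroupE(1)[OF subgroup_labels] by auto

lemma labels_mult: "x \<in> labels i \<Longrightarrow> y \<in> labels i \<Longrightarrow> x * y \<in> labels i"
  using K.subgroupE(4)[OF subgroup_labels] by simp

lemma labels_one: "1 \<in> labels i"
  using subgroup.one_closed[OF subgroup_labels] by simp

lemma loop_labels_subset: "x \<in> loop_labels i \<Longrightarrow> x \<in> labels i"
  unfolding labels_def by (rule generate.incl)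

text \<open>\<open>f\<^sub>i\<^sub>j\<^sub>k\<close> equals \<open>f\<^sub>i\<^sub>j\<^sub>l\<close>
  after the loop \<open>f\<^sub>j\<^sub>i\<^sub>l f\<^sub>i\<^sub>j\<^sub>k\<close>, and the loop is
  absorbed into the factor from \<open>labels i\<close>.\<close>

lemma change_axis:
  assumes "triple s i j k" "triple s i j l" "h \<in> labels i"
  obtains h' where "h' \<in> labels i" "h * (R i k / R j k) = h' * (R i l / R j l)"
proof
  show "h * (R i k / R j k * (R j l / R i l)) \<in> labels i"
    using loop_labelsI[OF assms(1) triple_swap[OF assms(2)]] loop_labels_subset labels_mult assms(3) by blast
  show "h * (R i k / R j k) = h * (R i k / R j k * (R j l / R i l)) * (R i l / R j l)"
    using cross_nz[OF assms(2)] by simp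
qed

text \<open>
  Up to a product of loops at \<open>i\<close>, an arrow from \<open>i\<close> to \<open>j\<close> is any one of the maps \<open>f\<^sub>i\<^sub>j\<^sub>k\<close>. For a step
  \<open>f\<^sub>j\<^sub>k\<^sub>l\<close> with \<open>l \<noteq> i\<close> use \<open>f\<^sub>j\<^sub>k\<^sub>l f\<^sub>i\<^sub>j\<^sub>l = f\<^sub>i\<^sub>k\<^sub>l\<close>; for \<open>l = i\<close> and a fourth index \<open>n\<close>, the composite
  \<open>f\<^sub>j\<^sub>k\<^sub>i f\<^sub>i\<^sub>j\<^sub>n\<close> is \<open>f\<^sub>i\<^sub>k\<^sub>n\<close> after the loop \<open>f\<^sub>n\<^sub>i\<^sub>k f\<^sub>i\<^sub>n\<^sub>j\<close>.
\<close>

lemma arrow_label: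
  assumes "arrow s L i j g"
  shows "\<exists>m. g = dil i j m \<and> (if j = i then m \<in> labels i
    else \<exists>h k. h \<in> labels i \<and> triple s i j k \<and> m = h * (R i k / R j k))"
  using assms
proof induction
  case ident
  then show ?case using dil_one[OF ident] labels_one[of i]
    by (intro exI[of _ 1]) (simp del: restrict_apply)
next
  case (step j g k l)
  note t = tripleD[OF step(2)]
  have i: "i \<in> {1..s}" using arrow_source[OF step(1)] .
  obtain m where g: "g = dil i j m" and m: "if j = i then m \<in> labels i
    else \<exists>h k. h \<in> labels i \<and> triple s i j k \<and> m = h * (R i k / R j k)"
    using step.IH by blast
  have m0: "m \<noteq> 0"
    using m labels_nz cross_nz by (auto split: if_splits)
  let ?m = "m * (R j l / R k l)"
  have comp: "compose (pts (L i)) (fmap L j k l) g = dil i k ?m"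
    using dil_compose[OF i t(1) m0] by (simp add: g fmap_eq_dil[OF step(2)])
  have "if k = i then ?m \<in> labels i
    else \<exists>h n. h \<in> labels i \<and> triple s i k n \<and> ?m = h * (R i n / R k n)"
  proof (cases "j = i")
    case True
    then show ?thesis using t m step(2) by auto
  next
    case ji: False
    then obtain h n where h: "h \<in> labels i" "triple s i j n" "m = h * (R i n / R j n)"
      using m by auto
    show ?thesis
    proof (cases "k = i")
      case True
      \<comment> \<open>The new step returns to \<open>i\<close>; together with
        \<open>f\<^sub>i\<^sub>j\<^sub>n\<close> it is itself a generating loop.\<close>
      then have "R i n / R j n * (R j l / R k l) \<in> labels i"
        using loop_labelsI[OF h(2), of l] step(2) loop_labels_subset by auto
      then have "?m \<in> labels i"
        using labels_mult[OF h(1)] h(3) by (metis mult.assoc)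
      then show ?thesis using True by simp
    next
      case ki: False
      have "\<exists>h n. h \<in> labels i \<and> triple s i k n \<and> ?m = h * (R i n / R k n)"
      proof (cases "l = i")
        case False
        have "triple s i j l" "triple s i k l"
          using False ki ji i t unfolding triple_def by auto
        moreover obtain h' where "h' \<in> labels i" "m = h' * (R i l / R j l)"
          using change_axis[OF h(2) \<open>triple s i j l\<close> h(1)] h(3) by metis
        moreover have "R j l \<noteq> 0" using R_nz t by blast
        ultimately show ?thesis
          by (intro exI[of _ h'] exI[of _ l]) simp
      next
        case True
        obtain n' where n': "n' \<in> {1..s}" "n' \<notin> {i, j, k}"
          by (rule fresh_index[of "{i, j, k}"]) (auto simp: card_insert_if)
        have tt: "triple s i j n'" "triple s i n' j" "triple s n' i k" "triple s i k n'"
          using n' ki ji i t unfolding triple_def by auto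
        obtain h' where h': "h' \<in> labels i" "m = h' * (R i n' / R j n')"
          using change_axis[OF h(2) tt(1) h(1)] h(3) by metis
        let ?x = "R i j / R n' j * (R n' k / R i k)"
        have "h' * ?x \<in> labels i"
          using labels_mult[OF h'(1) loop_labels_subset[OF loop_labelsI[OF tt(2,3)]]] .
        moreover have "R k n' \<noteq> 0" using R_nz t n' by blast
        then have "?m = h' * ?x * (R i n' / R k n')"
          unfolding h'(2) True R_sym[of n' k] R_sym[of n' j] R_sym[of j i] R_sym[of k i] by simp
        ultimately show ?thesis using tt(4) by blast
      qed
      then show ?thesis using ki by simp
    qed
  qed
  then show ?case unfolding comp by blast
qed

lemma inv_mult_group: "x \<noteq> 0 \<Longrightarrow> inv\<^bsub>mult_group TYPE('a)\<^esub> x = inverse x"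
  by (rule K.inv_equality) auto

lemma loop_labels_arrow:
  assumes "i \<in> {1..s}" "x \<in> loop_labels i"
  shows "arrow s L i i (dil i i x)"
proof -
  obtain j k l where x: "x = R i k / R j k * (R j l / R i l)"
    and t: "triple s i j k" "triple s j i l" using assms unfolding loop_labels_def by blast
  show ?thesis
    unfolding x using arrow_trans[OF arrow_triple[OF t(1)] arrow_triple[OF t(2)]] cross_nz t by blast
qed

lemma labels_arrow:
  assumes i: "i \<in> {1..s}" and "x \<in> labels i"
  shows "arrow s L i i (dil i i x)"
  using assms(2) unfolding labels_def
proof induction
  case one
  then show ?case using arrow_one[OF i] by simp
next
  case (incl h)
  then show ?case by (rule loop_labels_arrow[OF i])
next
  case (inv h)
  then show ?case using loop_labels_arrow[OF i loop_labels_inverse[OF inv]] inv_mult_group loop_labels_nz by simp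
next
  case (eng g h)
  then have "g \<noteq> 0" "h \<noteq> 0" using labels_nz unfolding labels_def by blast+
  then show ?case using arrow_trans[OF eng(3,4)] by simp
qed

section \<open>The vertex groups as subgroups of K^*\<close>

lemma vertex_carrier: "i \<in> {1..s} \<Longrightarrow> carrier (vertex_group s L i) = dil i i ` labels i"
  unfolding vertex_group_def Homs_def using arrow_label[of i i] labels_arrow by auto

lemma loops_eq: "loops s L i = dil i i ` loop_labels i"
proof -
  have "compose (pts (L i)) (fmap L j i l) (fmap L i j k) = dil i i (R i k / R j k * (R j l / R i l))"
    if "triple s i j k" "triple s j i l" for j k l
    using that tripleD[OF that(1)] dil_compose cross_nz[OF that(1)] by (simp add: fmap_eq_dil)
  then show ?thesis
    unfolding loops_def loop_labels_def by (auto simp: image_iff) metis+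
qed

lemma dil_iso:
  assumes i: "i \<in> {1..s}"
  shows "dil i i \<in> iso ((mult_group TYPE('a))\<lparr>carrier := labels i\<rparr>) (vertex_group s L i)"
proof (rule isoI)
  show "dil i i \<in> hom ((mult_group TYPE('a))\<lparr>carrier := labels i\<rparr>) (vertex_group s L i)"
  proof (rule homI)
    fix x y assume "x \<in> carrier ((mult_group TYPE('a))\<lparr>carrier := labels i\<rparr>)"
      "y \<in> carrier ((mult_group TYPE('a))\<lparr>carrier := labels i\<rparr>)"
    \<comment> \<open>In the composite, \<open>dil i i y\<close> is applied first, so
      \<open>dil_compose\<close> needs \<open>y\<close> nonzero and returns the scalars in the order
      \<open>y * x\<close>.\<close>
    then have "y \<noteq> 0" using labels_nz by simp
    then show "dil i i (x \<otimes>\<^bsub>(mult_group TYPE('a))\<lparr>carrier := labels i\<rparr>\<^esub> y)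
      = dil i i x \<otimes>\<^bsub>vertex_group s L i\<^esub> dil i i y"
      using dil_compose[OF i i] by (simp add: vertex_group_def mult.commute)
  qed (simp add: vertex_carrier[OF i])
  show "bij_betw (dil i i) (carrier ((mult_group TYPE('a))\<lparr>carrier := labels i\<rparr>))
    (carrier (vertex_group s L i))"
    unfolding bij_betw_def vertex_carrier[OF i]
    by (auto intro!: inj_onI dest: labels_nz intro: dil_inj[OF i i])
qed

lemma comm_group_labels: "comm_group ((mult_group TYPE('a))\<lparr>carrier := labels i\<rparr>)"
  using K.subgroup_imp_group[OF subgroup_labels]
  by (rule group.group_comm_groupI) (simp add: mult.commute)

lemma vertex_one: "i \<in> {1..s} \<Longrightarrow> \<one>\<^bsub>vertex_group s L i\<^esub> = dil i i 1"
  by (simp add: vertex_group_def dil_one)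

lemma comm_group_vertex:
  assumes i: "i \<in> {1..s}"
  shows "comm_group (vertex_group s L i)"
proof -
  \<comment> \<open>Transport along an isomorphism replaces the unit by the image of 1, which is the
    original unit by \<open>dil_one\<close>.\<close>
  have "comm_group (vertex_group s L i\<lparr>one := dil i i \<one>\<^bsub>(mult_group TYPE('a))\<lparr>carrier := labels i\<rparr>\<^esub>\<rparr>)"
    by (rule comm_group.iso_imp_img_comm_group[OF comm_group_labels dil_iso[OF i]])
  then show ?thesis
    by (simp add: vertex_group_def dil_one[OF i])
qed

lemma vertex_iso:
  assumes i: "i \<in> {1..s}"
  shows "(mult_group TYPE('a))\<lparr>carrier := labels i\<rparr> \<cong> vertex_group s L i"
  using dil_iso[OF i] by (rule is_isoI)

lemma vertex_iso_subgroup: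
  assumes i: "i \<in> {1..s}"
  shows "\<exists>H. subgroup H (mult_group TYPE('a)) \<and>
    vertex_group s L i \<cong> (mult_group TYPE('a))\<lparr>carrier := H\<rparr>"
  using subgroup_labels group.iso_sym[OF comm_group.axioms(2)[OF comm_group_labels] vertex_iso[OF i]]
  by blast

lemma finite_labels_iff: "i \<in> {1..s} \<Longrightarrow> finite (carrier (vertex_group s L i)) \<longleftrightarrow> finite (labels i)"
  using iso_finite[OF vertex_iso] by simp

lemma vertex_faithful:
  assumes i: "i \<in> {1..s}" and p: "p \<in> pts (L i) - (pts T1 \<union> pts T2)"
    and g: "g \<in> carrier (vertex_group s L i)" and gp: "g p = p"
  shows "g = \<one>\<^bsub>vertex_group s L i\<^esub>"
proof -
  obtain m where m: "g = dil i i m" "m \<in> labels i"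
    using g vertex_carrier[OF i] by auto
  have "dil i i m p = dil i i 1 p"
    using gp p m(1) dil_one[OF i] by simp
  then have "m = 1"
    using dil_pt_eqD[OF i i labels_nz[OF m(2)] p] by blast
  then show ?thesis using m(1) vertex_one[OF i] by simp
qed

text \<open>\<open>labels i\<close> is generated by the loop scalars by definition, and a
  homomorphism carries generated subgroups to generated subgroups.\<close>

lemma generate_loops:
  assumes i: "i \<in> {1..s}"
  shows "generate (vertex_group s L i) (loops s L i) = carrier (vertex_group s L i)"
proof -
  have hom: "group_hom ((mult_group TYPE('a))\<lparr>carrier := labels i\<rparr>) (vertex_group s L i) (dil i i)"
    by (rule group_hom.intro[OF comm_group.axioms(2)[OF comm_group_labels]
        comm_group.axioms(2)[OF comm_group_vertex[OF i]]
        group_hom_axioms.intro[OF iso_imp_homomorphism[OF dil_iso[OF i]]]])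
  have sub: "loop_labels i \<subseteq> labels i" using loop_labels_subset by blast
  have "generate (vertex_group s L i) (dil i i ` loop_labels i)
    = dil i i ` generate ((mult_group TYPE('a))\<lparr>carrier := labels i\<rparr>) (loop_labels i)"
    by (rule group_hom.generate_img[OF hom]) (simp add: sub)
  also have "generate ((mult_group TYPE('a))\<lparr>carrier := labels i\<rparr>) (loop_labels i) = labels i"
    unfolding K.generate_consistent[OF sub subgroup_labels] by (rule labels_def[symmetric])
  finally show ?thesis unfolding loops_eq vertex_carrier[OF i] .
qed

lemma dil_pow:
  assumes i: "i \<in> {1..s}" and "x \<in> labels i"
  shows "dil i i x [^]\<^bsub>vertex_group s L i\<^esub> (n :: nat) = dil i i (x ^ n)"
proof (induction n)
  case 0
  then show ?case by (simp add: vertex_one[OF i])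
next
  case (Suc n)
  interpret comm_group "vertex_group s L i" by (rule comm_group_vertex[OF i])
  have "dil i i x [^]\<^bsub>vertex_group s L i\<^esub> Suc n = compose (pts (L i)) (dil i i (x ^ n)) (dil i i x)"
    using Suc by (simp add: vertex_group_def)
  then show ?case using dil_compose[OF i i labels_nz[OF assms(2)]] by simp
qed

text \<open>The product of the finitely many exponents kills every generator and, by commutativity,
  the whole group, which therefore lies among the finitely many roots of unity of that
  exponent.\<close>

lemma finite_labels_if_torsion:
  assumes "\<And>x. x \<in> loop_labels i \<Longrightarrow> \<exists>n::nat. n > 0 \<and> x ^ n = 1"
  shows "finite (labels i)"
proof -
  obtain f :: "'a \<Rightarrow> nat" where f: "\<And>x. x \<in> loop_labels i \<Longrightarrow> f x > 0 \<and> x ^ f x = 1"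
    using assms by metis
  define N where "N = prod f (loop_labels i)"
  have N: "N > 0" unfolding N_def using f by (simp add: prod_pos)
  have *: "x ^ N = 1" if x: "x \<in> loop_labels i" for x
  proof -
    have "f x dvd N" unfolding N_def using finite_loop_labels x by (rule dvd_prodI)
    then obtain k where "N = f x * k" by blast
    then show ?thesis using f[OF x] by (simp add: power_mult)
  qed
  have "x ^ N = 1" if "x \<in> labels i" for x
    using that unfolding labels_def
  proof induction
    case (inv h)
    then show ?case using * inv_mult_group[OF loop_labels_nz[OF inv]] by (simp add: power_inverse)
  qed (use * in \<open>simp_all add: power_mult_distrib\<close>)
  then have "labels i \<subseteq> {x. x ^ N = 1}" by blast
  then show ?thesis using finite_roots_of_unity(1)[OF N] finite_subset by blast
qed

lemma finite_vertex_iff: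
  assumes i: "i \<in> {1..s}"
  shows "finite (carrier (vertex_group s L i)) \<longleftrightarrow>
    (\<forall>g\<in>loops s L i. \<exists>n::nat. n > 0 \<and> g [^]\<^bsub>vertex_group s L i\<^esub> n = \<one>\<^bsub>vertex_group s L i\<^esub>)"
proof
  interpret G: comm_group "vertex_group s L i" by (rule comm_group_vertex[OF i])
  assume fin: "finite (carrier (vertex_group s L i))"
  have "loops s L i \<subseteq> carrier (vertex_group s L i)"
    unfolding loops_eq vertex_carrier[OF i] using loop_labels_subset by blast
  then show "\<forall>g\<in>loops s L i. \<exists>n::nat. n > 0 \<and> g [^]\<^bsub>vertex_group s L i\<^esub> n = \<one>\<^bsub>vertex_group s L i\<^esub>"
    \<comment> \<open>The exponent is the order of the group.\<close>
    using G.pow_order_eq_1 fin G.order_gt_0_iff_finite by blast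
next
  assume tor: "\<forall>g\<in>loops s L i. \<exists>n::nat. n > 0 \<and> g [^]\<^bsub>vertex_group s L i\<^esub> n = \<one>\<^bsub>vertex_group s L i\<^esub>"
  have "finite (labels i)"
  proof (rule finite_labels_if_torsion)
    fix x assume x: "x \<in> loop_labels i"
    then obtain n :: nat where n: "n > 0" "dil i i (x ^ n) = dil i i 1"
      using tor dil_pow[OF i loop_labels_subset[OF x]] unfolding loops_eq vertex_one[OF i] by auto
    have "x ^ n = 1"
      using dil_inj[OF i i _ n(2)] loop_labels_nz[OF x] by simp
    then show "\<exists>n::nat. n > 0 \<and> x ^ n = 1" using n by blast
  qed
  then show "finite (carrier (vertex_group s L i))" using finite_labels_iff[OF i] by simp
qed

section \<open>Orbits\<close>

lemma orbit_eq:
  assumes i: "i \<in> {1..s}" and p: "p \<in> pts (L i)"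
  shows "orbit s L p = {dil i j m p | j m. m \<noteq> 0 \<and> j \<in> {1..s} \<and> arrow s L i j (dil i j m)}"
proof -
  \<comment> \<open>Skewness reduces the union over source lines in \<open>orbit\<close> to one
    term.\<close>
  have idx: "{k \<in> {1..s}. p \<in> pts (L k)} = {i}"
    using pts_disjoint[OF _ i _ p] i p by blast
  have "orbit s L p = {g p | g j. j \<in> {1..s} \<and> arrow s L i j g}"
    unfolding orbit_def Homs_def idx by blast
  also have "\<dots> = {dil i j m p | j m. m \<noteq> 0 \<and> j \<in> {1..s} \<and> arrow s L i j (dil i j m)}"
  proof (intro equalityI subsetI)
    fix x assume "x \<in> {g p | g j. j \<in> {1..s} \<and> arrow s L i j g}"
    then obtain g j where x: "x = g p" "arrow s L i j g" by blast
    then obtain m where "m \<noteq> 0" "g = dil i j m" "j \<in> {1..s}" by (elim arrow_dil)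
    then show "x \<in> {dil i j m p | j m. m \<noteq> 0 \<and> j \<in> {1..s} \<and> arrow s L i j (dil i j m)}"
      using x by blast
  qed blast
  finally show ?thesis .
qed

lemma orbitI:
  assumes "p \<in> pts (L i)" "m \<noteq> 0" "arrow s L i j (dil i j m)"
  shows "dil i j m p \<in> orbit s L p"
proof -
  have "j \<in> {1..s}" using assms(3) by (rule arrow_dil)
  then show ?thesis
    unfolding orbit_eq[OF arrow_source[OF assms(3)] assms(1)]
    by (intro CollectI exI[of _ j] exI[of _ m] conjI refl assms(2,3))
qed

lemma orbit_arrow_subset:
  assumes "p \<in> pts (L i)" "m \<noteq> 0" and a: "arrow s L i j (dil i j m)"
  shows "orbit s L (dil i j m p) \<subseteq> orbit s L p"
proof
  have ij: "i \<in> {1..s}" "j \<in> {1..s}" using a arrow_dil by blast+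
  have q: "dil i j m p \<in> pts (L j)" using dil_in_pts ij assms by blast
  fix x assume "x \<in> orbit s L (dil i j m p)"
  then obtain k n where k: "x = dil j k n (dil i j m p)" "n \<noteq> 0" "arrow s L j k (dil j k n)"
    unfolding orbit_eq[OF ij(2) q] by blast
  have "x = dil i k (m * n) p"
    using dil_compose[OF ij assms(2), of k n] assms(1) k(1) by (metis compose_eq)
  moreover have "arrow s L i k (dil i k (m * n))"
    using arrow_trans[OF a k(3) assms(2) k(2)] .
  ultimately show "x \<in> orbit s L p"
    using orbitI assms k by simp
qed

text \<open>The inclusion \<open>orbit_arrow_subset\<close>, applied also to the inverse arrow,
  gives equality.\<close>

lemma orbit_arrow:
  assumes p: "p \<in> pts (L i)" and m: "m \<noteq> 0" and a: "arrow s L i j (dil i j m)"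
  shows "orbit s L (dil i j m p) = orbit s L p"
proof
  show "orbit s L (dil i j m p) \<subseteq> orbit s L p" by (rule orbit_arrow_subset[OF assms])
  have ij: "i \<in> {1..s}" "j \<in> {1..s}" using a arrow_dil by blast+
  obtain n where n: "n \<noteq> 0" "dil i j m = dil i j n" "arrow s L j i (dil j i (inverse n))"
    using arrow_inverse[OF a] by blast
  have "n = m" using dil_inj[OF ij m n(2)] by simp
  have q: "dil i j m p \<in> pts (L j)" using dil_in_pts[OF ij m p] .
  have "dil j i (inverse m) (dil i j m p) = dil i i 1 p"
    using dil_compose[OF ij m, of i "inverse m"] m p by (metis compose_eq right_inverse)
  then have "dil j i (inverse m) (dil i j m p) = p"
    using p ij by (simp add: dil_one)
  then show "orbit s L p \<subseteq> orbit s L (dil i j m p)"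
    using orbit_arrow_subset[OF q, of "inverse m" i] n(3) m unfolding \<open>n = m\<close> by simp
qed

lemma dil_off:
  assumes "i \<in> {1..s}" "j \<in> {1..s}" "m \<noteq> 0" "p \<in> pts (L i) - (pts T1 \<union> pts T2)"
  shows "dil i j m p \<in> pts (L j) - (pts T1 \<union> pts T2)"
proof -
  obtain b where "p = pt i 1 b" "b \<noteq> 0" using pts_off_E assms by blast
  then show ?thesis using assms pt_off[of j "m * b"] by (simp add: dil_pt)
qed

lemma all_pts_E:
  assumes "p \<in> all_pts s L"
  obtains i where "i \<in> {1..s}" "p \<in> pts (L i)"
  using assms unfolding all_pts_def by blast

text \<open>Handles both transversals at once: \<open>c * b = a * d\<close> says that (c : d) = (a :
  b), which for \<open>b = 0\<close> or \<open>a = 0\<close> singles out the points on one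
  transversal. Scalars do not move such a point within its line, so its orbit has exactly one point
  on each line.\<close>

lemma transversal_orbit:
  assumes i: "i \<in> {1..s}" and ab: "a \<noteq> 0 \<or> b \<noteq> 0" and "a = 0 \<or> b = 0"
    and mem: "\<And>j c d. j \<in> {1..s} \<Longrightarrow> c \<noteq> 0 \<or> d \<noteq> 0 \<Longrightarrow> pt j c d \<in> pts T \<longleftrightarrow> c * b = a * d"
  shows "orbit s L (pt i a b) = pts T \<inter> all_pts s L"
proof
  note p = pt_in_pts[OF i ab]
  show "orbit s L (pt i a b) \<subseteq> pts T \<inter> all_pts s L"
  proof
    fix x assume "x \<in> orbit s L (pt i a b)"
    then obtain j m where x: "x = dil i j m (pt i a b)" "m \<noteq> 0" "j \<in> {1..s}"
      unfolding orbit_eq[OF i p] by blast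
    then have "x = pt j a (m * b)" using dil_pt[OF i ab] by simp
    moreover have "a \<noteq> 0 \<or> m * b \<noteq> 0" using ab x by simp
    ultimately show "x \<in> pts T \<inter> all_pts s L"
      using mem[OF x(3), of a "m * b"] pt_in_pts[OF x(3), of a "m * b"] assms(3) x(3)
      unfolding all_pts_def by auto
  qed
  show "pts T \<inter> all_pts s L \<subseteq> orbit s L (pt i a b)"
  proof
    fix x assume x: "x \<in> pts T \<inter> all_pts s L"
    then obtain j where j: "j \<in> {1..s}" "x \<in> pts (L j)" using all_pts_E by blast
    then obtain c d where cd: "x = pt j c d" "c \<noteq> 0 \<or> d \<noteq> 0" using pts_E by blast
    have eq: "c * b = a * d" using mem[OF j(1) cd(2)] x cd by simp
    obtain m where m: "m \<noteq> 0" "arrow s L i j (dil i j m)" using arrow_exists[OF i j(1)] .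
    have "x = pt j a (m * b)"
    proof (cases "a = 0")
      case True
      then have "b \<noteq> 0" "c = 0" "d \<noteq> 0" using ab eq cd by auto
      then show ?thesis
        using pt_scale[of "m * b / d" j 0 d] m True cd by simp
    next
      case False
      then have "b = 0" "d = 0" "c \<noteq> 0" using assms(3) eq cd by auto
      then show ?thesis
        using pt_scale[of "a / c" j c 0] False cd by simp
    qed
    then have "x = dil i j m (pt i a b)" using dil_pt[OF i ab] by simp
    then show "x \<in> orbit s L (pt i a b)" using orbitI[OF p m] by simp
  qed
qed

lemma orbit_classification:
  assumes "O' \<in> orbits s L"
  shows "O' = pts T1 \<inter> all_pts s L \<or> O' = pts T2 \<inter> all_pts s L \<or>
    (\<exists>p\<in>all_pts s L - (pts T1 \<union> pts T2). O' = orbit s L p)"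
proof -
  obtain p where p: "p \<in> all_pts s L" "O' = orbit s L p" using assms unfolding orbits_def by blast
  obtain i where i: "i \<in> {1..s}" "p \<in> pts (L i)" using all_pts_E[OF p(1)] .
  obtain a b where ab: "p = pt i a b" "a \<noteq> 0 \<or> b \<noteq> 0" using pts_E[OF i] .
  consider "b = 0" | "a = 0" | "p \<notin> pts T1 \<union> pts T2"
    using pt_in_T1[OF i(1) ab(2)] pt_in_T2[OF i(1) ab(2)] ab(1) by blast
  then show ?thesis
  proof cases
    case 1
    then have "O' = pts T1 \<inter> all_pts s L"
      unfolding p(2) ab(1) by (intro transversal_orbit[OF i(1) ab(2)]) (use ab(2) pt_in_T1 in auto)
    then show ?thesis ..
  next
    case 2
    then have "O' = pts T2 \<inter> all_pts s L"
      unfolding p(2) ab(1) by (intro transversal_orbit[OF i(1) ab(2)]) (use ab(2) pt_in_T2 in auto)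
    then show ?thesis by blast
  next
    case 3
    then show ?thesis using p by blast
  qed
qed

text \<open>After division, the nondegeneracy inequality says that the loop
  \<open>f\<^sub>j\<^sub>i\<^sub>l f\<^sub>i\<^sub>j\<^sub>k\<close> has scalar different from
  1.\<close>

lemma nontrivial_label: "\<exists>i x. i \<in> {1..s} \<and> x \<in> loop_labels i \<and> x \<noteq> 1"
proof -
  obtain i j k l where ijkl: "{i, j, k, l} \<subseteq> {1..s}" "distinct [i, j, k, l]"
    and ne: "R i k * R j l \<noteq> R i l * R j k"
    using nondegenerate unfolding R_def by blast
  have t: "triple s i j k" "triple s j i l" using ijkl unfolding triple_def by auto
  have "R j k \<noteq> 0" "R i l \<noteq> 0" using R_nz ijkl by auto
  then have "R i k / R j k * (R j l / R i l) \<noteq> 1"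
    using ne by (simp add: field_simps)
  then show ?thesis using loop_labelsI[OF t] ijkl(1) by blast
qed

text \<open>Arrows from \<open>p\<close> give one orbit point \<open>q j\<close> on each of the
  \<open>s\<close> lines; a nontrivial loop at \<open>k\<close> moves \<open>q k\<close> to a second
  point of \<open>L k\<close>. The infinite case is listed separately because \<open>card\<close> is
  0 there.\<close>

lemma card_orbit_gt:
  assumes p: "p \<in> all_pts s L - (pts T1 \<union> pts T2)"
  shows "infinite (orbit s L p) \<or> card (orbit s L p) > s"
proof -
  obtain i where i: "i \<in> {1..s}" "p \<in> pts (L i)" using all_pts_E p by blast
  have "\<forall>j\<in>{1..s}. \<exists>m. m \<noteq> 0 \<and> arrow s L i j (dil i j m)"
    using arrow_exists[OF i(1)] by blast
  from bchoice[OF this] obtain m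
    where m': "\<forall>j\<in>{1..s}. m j \<noteq> 0 \<and> arrow s L i j (dil i j (m j))" ..
  have m: "m j \<noteq> 0" "arrow s L i j (dil i j (m j))" if "j \<in> {1..s}" for j
    using m' that by blast+
  define q where "q j = dil i j (m j) p" for j
  have q: "q j \<in> pts (L j) - (pts T1 \<union> pts T2)" "q j \<in> orbit s L p" if "j \<in> {1..s}" for j
    using dil_off[OF i(1) that m(1)[OF that]] orbitI[OF i(2) m[OF that]] p i(2) unfolding q_def by blast+
  obtain k x where k: "k \<in> {1..s}" and x: "x \<in> loop_labels k" "x \<noteq> 1" using nontrivial_label by blast
  define q' where "q' = dil k k x (q k)"
  have x0: "x \<noteq> 0" using loop_labels_nz x by blast
  have q': "q' \<in> pts (L k)"
    using dil_in_pts[OF k k x0] q[OF k] unfolding q'_def by blast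
  have "q' \<in> orbit s L (q k)"
    unfolding q'_def using orbitI[of "q k" k x k] q[OF k] x0 loop_labels_arrow[OF k x(1)] by blast
  then have q'orb: "q' \<in> orbit s L p"
    using orbit_arrow[OF i(2) m[OF k]] unfolding q_def by simp
  have "q' \<noteq> q k"
  proof
    assume "q' = q k"
    then have "dil k k x (q k) = dil k k 1 (q k)"
      using q[OF k] k by (simp add: q'_def dil_one)
    then show False using dil_pt_eqD[OF k k x0] q(1)[OF k] x(2) by blast
  qed
  have new: "q' \<notin> q ` {1..s}"
  proof
    assume "q' \<in> q ` {1..s}"
    then obtain j where j: "j \<in> {1..s}" "q' = q j" by blast
    have "q j \<in> pts (L k)" using q' j(2) by simp
    then have "j = k" using pts_disjoint[OF j(1) k] q(1)[OF j(1)] by blast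
    then show False using j \<open>q' \<noteq> q k\<close> by simp
  qed
  have "inj_on q {1..s}"
  proof (rule inj_onI)
    fix j j' assume j: "j \<in> {1..s}" "j' \<in> {1..s}" "q j = q j'"
    then have "q j \<in> pts (L j')" using q(1)[OF j(2)] by simp
    then show "j = j'" using pts_disjoint[OF j(1,2)] q(1)[OF j(1)] by blast
  qed
  then have "card (insert q' (q ` {1..s})) = Suc s"
    using new by (simp add: card_image)
  moreover have "insert q' (q ` {1..s}) \<subseteq> orbit s L p" using q'orb q by blast
  ultimately show ?thesis
    using card_mono[of "orbit s L p" "insert q' (q ` {1..s})"] by linarith
qed

text \<open>An arrow brings \<open>p\<close> to the line of \<open>q\<close> without changing its
  orbit. If the two points are then (1 : b) and (1 : c), the matrix fixing every \<open>u k\<close>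
  and scaling every \<open>w k\<close> by c / b takes one to the other and commutes with all
  arrows.\<close>

lemma orbits_equivalent:
  assumes p: "p \<in> all_pts s L - (pts T1 \<union> pts T2)" and q: "q \<in> all_pts s L - (pts T1 \<union> pts T2)"
  shows "proj_equivalent (orbit s L p) (orbit s L q)"
proof -
  obtain i where i: "i \<in> {1..s}" "p \<in> pts (L i)" using all_pts_E p by blast
  obtain j where j: "j \<in> {1..s}" "q \<in> pts (L j)" using all_pts_E q by blast
  obtain m where m: "m \<noteq> 0" "arrow s L i j (dil i j m)" using arrow_exists[OF i(1) j(1)] .
  obtain b where b: "dil i j m p = pt j 1 b" "b \<noteq> 0"
    using pts_off_E[OF j(1) dil_off[OF i(1) j(1) m(1)]] p i by blast
  obtain c where c: "q = pt j 1 c" "c \<noteq> 0" using pts_off_E[OF j(1)] q j by blast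
  have "c / b \<noteq> 0" using b c by simp
  then obtain M :: "'a ^ 4 ^ 4" where M: "invertible M"
    and Mu: "\<And>k. k \<in> {1..s} \<Longrightarrow> M *v u k = u k"
    and Mw: "\<And>k. k \<in> {1..s} \<Longrightarrow> M *v w k = (c / b) *s w k"
    using scaling by blast
  have Mpt: "(*v) M ` pt k x y = pt k x (c / b * y)" if k: "k \<in> {1..s}" for k x y
  proof -
    have "(*v) M ` pt k x y = {M *v v | v. v \<in> pt k x y}" by blast
    also have "\<dots> = {M *v ((z * x) *s u k + (z * y) *s w k) | z. True}"
      unfolding pt_iff by blast
    also have "\<dots> = {(z * x) *s u k + (z * (c / b * y)) *s w k | z. True}"
      by (simp add: matrix_vector_right_distrib vector_scalar_commute Mu[OF k] Mw[OF k] ac_simps)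
    also have "\<dots> = pt k x (c / b * y)"
      unfolding set_eq_iff pt_iff by simp
    finally show ?thesis .
  qed
  have orb: "orbit s L (pt j 1 y) =
    {pt k 1 (n * y) | k n. n \<noteq> 0 \<and> k \<in> {1..s} \<and> arrow s L j k (dil j k n)}" for y
    using orbit_eq[OF j(1) pt_in_pts[OF j(1), of 1 y]] dil_pt[OF j(1), of 1 y] by simp
  have "orbit s L p = orbit s L (pt j 1 b)"
    using orbit_arrow[OF i(2) m] b(1) by simp
  also have "(\<lambda>p. (*v) M ` p) ` \<dots> =
    {pt k 1 (n * c) | k n. n \<noteq> 0 \<and> k \<in> {1..s} \<and> arrow s L j k (dil j k n)}"
    unfolding orb
  proof (rule image_Collect2)
    fix k n assume "n \<noteq> 0 \<and> k \<in> {1..s} \<and> arrow s L j k (dil j k n)"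
    then show "(*v) M ` pt k 1 (n * b) = pt k 1 (n * c)"
      using Mpt[of k 1 "n * b"] b(2) by (simp add: mult.commute)
  qed
  also have "\<dots> = orbit s L q" unfolding c(1) orb ..
  finally have "(\<lambda>p. (*v) M ` p) ` orbit s L p = orbit s L q" .
  then show ?thesis unfolding proj_equivalent_def by (intro exI[of _ M] conjI M)
qed

text \<open>Acting on \<open>p\<close> embeds \<open>labels i\<close> in the orbit, so it is a
  finite subgroup of K^*.\<close>

lemma finite_orbit_imp_cyclic:
  assumes i: "i \<in> {1..s}" and p: "p \<in> pts (L i) - (pts T1 \<union> pts T2)" and fin: "finite (orbit s L p)"
  shows "finite (carrier (vertex_group s L i)) \<and> cyclic_group (vertex_group s L i)"
proof -
  have "(\<lambda>x. dil i i x p) ` labels i \<subseteq> orbit s L p"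
    using orbitI[of p i _ i] p labels_nz labels_arrow[OF i] by blast
  moreover have "inj_on (\<lambda>x. dil i i x p) (labels i)"
    using dil_pt_eqD[OF i i labels_nz p] by (auto intro!: inj_onI)
  ultimately have finl: "finite (labels i)"
    using fin by (meson finite_imageD finite_subset)
  have "cyclic_group ((mult_group TYPE('a))\<lparr>carrier := labels i\<rparr>)"
    by (rule finite_subgroup_mult_group_cyclic[OF subgroup_labels finl])
  then have "cyclic_group (vertex_group s L i)"
    using isomorphic_group_cyclicity[OF vertex_iso[OF i] comm_group.axioms(2)[OF comm_group_labels]
        comm_group.axioms(2)[OF comm_group_vertex[OF i]]] by simp
  then show ?thesis using finl finite_labels_iff[OF i] by simp
qed

end

section \<open>Coordinates adapted to the transversals\<close>

text \<open>In coordinates y = P x the form is y1 y4 - c y2 y3. Its gradient is the transpose of P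
  applied to (y4, -c y3, -c y2, y1), which vanishes only for y = 0, in every characteristic.\<close>

lemma smooth_hyperboloid:
  fixes P E :: "'a :: field ^ 4 ^ 4"
  assumes PE: "P ** E = mat 1" and EP: "E ** P = mat 1" and c: "c \<noteq> 0"
  shows "smooth_quadric (\<chi> m n. P $ 1 $ m * P $ 4 $ n - c * P $ 2 $ m * P $ 3 $ n)"
proof -
  let ?Q = "\<chi> m n. P $ 1 $ m * P $ 4 $ n - c * P $ 2 $ m * P $ 3 $ n"
  define P' E' :: "'a alg_closure ^ 4 ^ 4"
    where "P' = map_matrix to_ac P" and "E' = map_matrix to_ac E"
  have map_mult: "map_matrix to_ac (A ** B) = map_matrix to_ac A ** map_matrix to_ac B"
    for A B :: "'a ^ 4 ^ 4"
    by (simp add: vec_eq_iff matrix_matrix_mult_def to_ac_sum)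
  have map_one: "map_matrix to_ac (mat 1 :: 'a ^ 4 ^ 4) = mat 1"
    by (simp add: vec_eq_iff mat_def)
  have PE': "P' ** E' = mat 1" and EP': "E' ** P' = mat 1"
    unfolding P'_def E'_def map_mult[symmetric] PE EP map_one by (rule refl)+
  have "x = 0" if grad: "quad_grad (map_matrix to_ac ?Q) x = 0" for x
  proof -
    define y where "y = P' *v x"
    have "quad_grad (map_matrix to_ac ?Q) x $ k = P' $ 1 $ k * y $ 4 + P' $ 4 $ k * y $ 1
      - to_ac c * (P' $ 2 $ k * y $ 3 + P' $ 3 $ k * y $ 2)" for k
      unfolding quad_grad_def y_def matrix_vector_mult_def P'_def
      by (simp add: sum_4 algebra_simps)
    then have g: "P' $ 1 $ k * y $ 4 + P' $ 4 $ k * y $ 1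
      - to_ac c * (P' $ 2 $ k * y $ 3 + P' $ 3 $ k * y $ 2) = 0" for k
      using grad by simp
    have d: "(\<Sum>k\<in>UNIV. P' $ j $ k * E' $ k $ m) = (if j = m then 1 else 0)" for j m
      using PE' by (simp add: vec_eq_iff matrix_matrix_mult_def mat_def)
    have "(if 1 = m then y $ 4 else 0) + (if 4 = m then y $ 1 else 0)
      - to_ac c * ((if 2 = m then y $ 3 else 0) + (if 3 = m then y $ 2 else 0)) = 0" for m :: 4
    proof -
      \<comment> \<open>Pairing the gradient with column \<open>m\<close> of \<open>E'\<close>
        undoes the transpose of \<open>P'\<close> and isolates one coordinate of
        \<open>y\<close>.\<close>
      have "0 = (\<Sum>k\<in>UNIV. (P' $ 1 $ k * y $ 4 + P' $ 4 $ k * y $ 1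
        - to_ac c * (P' $ 2 $ k * y $ 3 + P' $ 3 $ k * y $ 2)) * E' $ k $ m)"
        by (simp add: g)
      also have "\<dots> = (\<Sum>k\<in>UNIV. P' $ 1 $ k * E' $ k $ m) * y $ 4 + (\<Sum>k\<in>UNIV. P' $ 4 $ k * E' $ k $ m) * y $ 1
        - to_ac c * ((\<Sum>k\<in>UNIV. P' $ 2 $ k * E' $ k $ m) * y $ 3 + (\<Sum>k\<in>UNIV. P' $ 3 $ k * E' $ k $ m) * y $ 2)"
        by (simp add: sum_4 algebra_simps)
      finally show ?thesis unfolding d by (simp split: if_splits)
    qed
    from this[of 1] this[of 2] this[of 3] this[of 4]
    have "y $ k = 0" for k
      using c exhaust_4[of k] by auto
    then have "y = 0" by (simp add: vec_eq_iff)
    have "x = (E' ** P') *v x" by (simp add: EP')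
    also have "\<dots> = E' *v y" by (simp add: y_def matrix_vector_mul_assoc)
    finally show ?thesis using \<open>y = 0\<close> by simp
  qed
  then show ?thesis unfolding smooth_quadric_def by blast
qed

lemma quad_form_hyperboloid:
  fixes P :: "'a :: field ^ 4 ^ 4"
  shows "quad_form (\<chi> m n. P $ 1 $ m * P $ 4 $ n - c * P $ 2 $ m * P $ 3 $ n) v
    = (P *v v) $ 1 * (P *v v) $ 4 - c * (P *v v) $ 2 * (P *v v) $ 3"
  unfolding quad_form_def matrix_vector_mult_def
  by (simp add: sum_4 algebra_simps)

lemma pts_nonempty_E:
  assumes "pts V \<inter> pts W \<noteq> {}"
  obtains v where "v \<noteq> 0" "v \<in> V" "v \<in> W"
proof -
  obtain p where p: "vec.subspace p" "vec.dim p = 1" "p \<subseteq> V" "p \<subseteq> W"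
    using assms unfolding pts_def by blast
  have "p \<noteq> {0}" using p(2) by auto
  then obtain v where "v \<in> p" "v \<noteq> 0" using p(1) vec.subspace_0 by blast
  then show ?thesis using that p by blast
qed

lemma pts_disjoint_zero:
  assumes "pts V \<inter> pts W = {}" "vec.subspace V" "vec.subspace W" "v \<in> V" "v \<in> W"
  shows "v = 0"
proof (rule ccontr)
  assume "v \<noteq> 0"
  then have "vec.dim (vec.span {v}) = 1"
    using vec.dim_span_eq_card_independent[of "{v}"] by simp
  moreover have "vec.span {v} \<subseteq> V" "vec.span {v} \<subseteq> W"
    by (rule vec.span_minimal; simp add: assms)+
  ultimately have "vec.span {v} \<in> pts V \<inter> pts W" unfolding pts_def by simp
  then show False using assms(1) by blast
qed

lemma proj_line_span:
  assumes V: "proj_line V" and xy: "x \<in> V" "y \<in> V" "x \<noteq> 0"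
    and ind: "\<And>c. y \<noteq> c *s x"
  shows "V = {a *s x + b *s y | a b. True}"
proof
  have sub: "vec.subspace V" and dim: "vec.dim V = 2" using V unfolding proj_line_def by auto
  show "{a *s x + b *s y | a b. True} \<subseteq> V"
    using xy sub by (auto intro!: vec.subspace_add vec.subspace_scale)
  have "y \<notin> vec.span {x}" using ind by (auto simp: vec.span_singleton)
  then have i: "vec.independent {y, x}" and ne: "x \<noteq> y"
    using xy(3) vec.span_base[of x "{x}"] by (auto simp: vec.independent_insert)
  then have "V \<subseteq> vec.span {y, x}"
    using vec.card_ge_dim_independent[of "{y, x}" V] xy dim by simp
  then show "V \<subseteq> {a *s x + b *s y | a b. True}"
  proof (intro subsetI)
    fix v assume "v \<in> V"
    then have "v \<in> vec.span {y, x}" using \<open>V \<subseteq> vec.span {y, x}\<close> by blast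
    then obtain b where "v - b *s y \<in> vec.span {x}" using vec.span_breakdown_eq by blast
    then obtain a where "v - b *s y = a *s x" by (auto simp: vec.span_singleton)
    then have "v = a *s x + b *s y" by (simp add: algebra_simps)
    then show "v \<in> {a *s x + b *s y | a b. True}" by blast
  qed
qed

lemma transversal_meets:
  assumes "transversal s L T" "i \<in> {1..s}"
  obtains v where "v \<noteq> 0" "v \<in> T" "v \<in> L i"
proof -
  have "pts T \<inter> pts (L i) \<noteq> {}" using assms unfolding transversal_def by blast
  then show ?thesis using that by (rule pts_nonempty_E)
qed

text \<open>
  If \<open>T1\<close> and \<open>T2\<close> met, any two of the lines that avoid the common point would lie in the plane
  spanned by \<open>T1\<close> and \<open>T2\<close>, hence meet; at most one line passes through the common point.
\<close>

lemma transversals_skew: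
  fixes L :: "nat \<Rightarrow> ('a :: field ^ 4) set"
  assumes s: "s \<ge> 4" and skew: "skew_lines s L" and T: "transversal s L T1" "transversal s L T2"
    and ne: "T1 \<noteq> T2" and v: "v \<in> T1" "v \<in> T2"
  shows "v = 0"
proof (rule ccontr)
  assume v0: "v \<noteq> 0"
  have L: "proj_line (L i)" "vec.subspace (L i)" if "i \<in> {1..s}" for i
    using skew that unfolding skew_lines_def proj_line_def by auto
  have TT: "proj_line T1" "proj_line T2" "vec.subspace T1" "vec.subspace T2"
    using T unfolding transversal_def proj_line_def by auto
  have zero: "x = 0" if "i \<in> {1..s}" "j \<in> {1..s}" "i \<noteq> j" "x \<in> L i" "x \<in> L j" for i j x
    using pts_disjoint_zero[of "L i" "L j" x] L that skew unfolding skew_lines_def by blast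
  have main: False if jk: "j \<in> {1..s}" "k \<in> {1..s}" "j \<noteq> k" and out: "v \<notin> L j" "v \<notin> L k" for j k
  proof -
    obtain aj where aj: "aj \<noteq> 0" "aj \<in> T1" "aj \<in> L j"
      by (rule transversal_meets[OF T(1) jk(1)])
    obtain ak where ak: "ak \<noteq> 0" "ak \<in> T1" "ak \<in> L k"
      by (rule transversal_meets[OF T(1) jk(2)])
    obtain bj where bj: "bj \<noteq> 0" "bj \<in> T2" "bj \<in> L j"
      by (rule transversal_meets[OF T(2) jk(1)])
    obtain bk where bk: "bk \<noteq> 0" "bk \<in> T2" "bk \<in> L k"
      by (rule transversal_meets[OF T(2) jk(2)])
    have nm: "v \<noteq> c *s x" if "x \<in> L i" "v \<notin> L i" "i \<in> {1..s}" for c x i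
      using vec.subspace_scale[OF L(2)[OF that(3)] that(1)] that(2) by metis
    obtain y x where xy: "ak = y *s aj + x *s v"
      using proj_line_span[OF TT(1) aj(2) v(1) aj(1) nm[OF aj(3) out(1) jk(1)]] ak(2)
      by blast
    obtain y' x' where xy': "bk = y' *s bj + x' *s v"
      using proj_line_span[OF TT(2) bj(2) v(2) bj(1) nm[OF bj(3) out(1) jk(1)]] bk(2)
      by blast
    have x: "x \<noteq> 0"
      using zero[OF jk(1,2,3), of ak] ak xy vec.subspace_scale[OF L(2)[OF jk(1)] aj(3)] by auto
    \<comment> \<open>Eliminating \<open>v\<close> from the two expansions produces a vector lying
      in both \<open>L j\<close> and \<open>L k\<close>.\<close>
    have "x' *s ak - x *s bk = (x' * y) *s aj - (x * y') *s bj"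
      unfolding xy xy' by (simp add: vec.scale_right_distrib algebra_simps)
    moreover have "(x' * y) *s aj - (x * y') *s bj \<in> L j"
      by (intro vec.subspace_diff vec.subspace_scale L(2) jk aj bj)
    moreover have "x' *s ak - x *s bk \<in> L k"
      by (intro vec.subspace_diff vec.subspace_scale L(2) jk ak bk)
    ultimately have "x' *s ak - x *s bk = 0" using zero[OF jk] by metis
    then have "x' *s ak = x *s bk" by simp
    then have "(1 / x) *s (x' *s ak) = (1 / x) *s (x *s bk)" by simp
    then have bk_eq: "bk = (x' / x) *s ak" using x by simp
    then have "x' / x \<noteq> 0" using bk(1) by auto
    then have "ak = (x / x') *s bk" using bk_eq by simp
    \<comment> \<open>Now \<open>ak\<close> and \<open>v\<close> lie on both transversals and span
      each of them, contradicting \<open>T1 \<noteq> T2\<close>.\<close>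
    then have akT2: "ak \<in> T2" using vec.subspace_scale[OF TT(4) bk(2)] by simp
    have "T1 = {a *s ak + b *s v | a b. True}"
      by (rule proj_line_span[OF TT(1) ak(2) v(1) ak(1) nm[OF ak(3) out(2) jk(2)]])
    moreover have "T2 = {a *s ak + b *s v | a b. True}"
      by (rule proj_line_span[OF TT(2) akT2 v(2) ak(1) nm[OF ak(3) out(2) jk(2)]])
    ultimately show False using ne by simp
  qed
  have I: "1 \<in> {1..s}" "2 \<in> {1..s}" "3 \<in> {1..s}" using s by auto
  have "v \<notin> L 2 \<and> v \<notin> L 3" if "v \<in> L 1"
    using zero[OF I(1,2)] zero[OF I(1,3)] that v0 by auto
  moreover have "v \<notin> L 1 \<and> v \<notin> L 3" if "v \<in> L 2"
    using zero[OF I(2,1)] zero[OF I(2,3)] that v0 by auto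
  ultimately show False
    using main[OF I(2,3)] main[OF I(1,3)] main[OF I(1,2)] by auto
qed

text \<open>\<open>E\<close> has the given vectors as columns; its inverse \<open>P\<close> reads
  off coordinates in that basis.\<close>

lemma frame_matrix:
  fixes e1 e2 e3 e4 :: "'a :: field ^ 4"
  assumes "\<And>a b c d. a *s e1 + b *s e2 + c *s e3 + d *s e4 = 0 \<Longrightarrow> a = 0 \<and> b = 0 \<and> c = 0 \<and> d = 0"
  obtains E P :: "'a ^ 4 ^ 4" where "P ** E = mat 1" "E ** P = mat 1"
    "\<And>x. E *v x = x $ 1 *s e1 + x $ 2 *s e2 + x $ 3 *s e3 + x $ 4 *s e4"
proof -
  define E :: "'a ^ 4 ^ 4" where
    "E = (\<chi> i j. (if j = 1 then e1 else if j = 2 then e2 else if j = 3 then e3 else e4) $ i)"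
  have E: "E *v x = x $ 1 *s e1 + x $ 2 *s e2 + x $ 3 *s e3 + x $ 4 *s e4" for x
    by (simp add: E_def vec_eq_iff matrix_vector_mult_def sum_4 mult.commute)
  have "x = 0" if "E *v x = 0" for x
    using assms[of "x $ 1" "x $ 2" "x $ 3" "x $ 4"] that unfolding E
    by (simp add: vec_eq_iff forall_4)
  then obtain P :: "'a ^ 4 ^ 4" where P: "P ** E = mat 1" using matrix_left_invertible_ker[of E] by blast
  then have "E ** P = mat 1" using matrix_left_right_inverse by blast
  then show ?thesis using that P E by blast
qed

definition quadvec :: "'a :: zero \<Rightarrow> 'a \<Rightarrow> 'a \<Rightarrow> 'a \<Rightarrow> 'a ^ 4" where
  "quadvec a b c d = (\<chi> k. if k = 1 then a else if k = 2 then b else if k = 3 then c else d)"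

lemma quadvec_nth [simp]:
  "quadvec a b c d $ 1 = a" "quadvec a b c d $ 2 = b" "quadvec a b c d $ 3 = c" "quadvec a b c d $ 4 = d"
  by (simp_all add: quadvec_def)

lemma two_transversals_frame:
  fixes L :: "nat \<Rightarrow> ('a :: field ^ 4) set"
  assumes s: "s \<ge> 4" and skew: "skew_lines s L"
    and nosmooth: "\<nexists>Q. smooth_quadric Q \<and> (\<forall>i\<in>{1..s}. pts (L i) \<subseteq> quadric_pts Q)"
    and T1: "transversal s L T1" and T2: "transversal s L T2" and ne: "T1 \<noteq> T2"
  shows "\<exists>u w A C. two_transversals s L T1 T2 u w A C"
proof -
  have L: "proj_line (L i)" "vec.subspace (L i)" if "i \<in> {1..s}" for i
    using skew that unfolding skew_lines_def proj_line_def by auto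
  have lineT: "proj_line T1" "proj_line T2" and subT: "vec.subspace T1" "vec.subspace T2"
    using T1 T2 unfolding transversal_def proj_line_def by auto
  have zero: "x = 0" if "i \<in> {1..s}" "j \<in> {1..s}" "i \<noteq> j" "x \<in> L i" "x \<in> L j" for i j x
    using pts_disjoint_zero[of "L i" "L j" x] L that skew unfolding skew_lines_def by blast
  have TT: "v = 0" if "v \<in> T1" "v \<in> T2" for v
    by (rule transversals_skew[OF s skew T1 T2 ne that])
  have "\<forall>i\<in>{1..s}. \<exists>v. v \<noteq> 0 \<and> v \<in> T1 \<and> v \<in> L i" using transversal_meets[OF T1] by metis
  from bchoice[OF this] obtain u where u': "\<forall>i\<in>{1..s}. u i \<noteq> 0 \<and> u i \<in> T1 \<and> u i \<in> L i" ..
  then have u: "u i \<noteq> 0" "u i \<in> T1" "u i \<in> L i" if "i \<in> {1..s}" for i using that by simp_all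
  have "\<forall>i\<in>{1..s}. \<exists>v. v \<noteq> 0 \<and> v \<in> T2 \<and> v \<in> L i" using transversal_meets[OF T2] by metis
  from bchoice[OF this] obtain w where w': "\<forall>i\<in>{1..s}. w i \<noteq> 0 \<and> w i \<in> T2 \<and> w i \<in> L i" ..
  then have w: "w i \<noteq> 0" "w i \<in> T2" "w i \<in> L i" if "i \<in> {1..s}" for i using that by simp_all
  have Tu: "a *s u i \<in> T1" and Tw: "a *s w i \<in> T2" if "i \<in> {1..s}" for a i
    using vec.subspace_scale subT u w that by blast+
  have line: "L i = {a *s u i + b *s w i | a b. True}" if i: "i \<in> {1..s}" for i
  proof (rule proj_line_span[OF L(1)[OF i] u(3)[OF i] w(3)[OF i] u(1)[OF i]])
    fix c
    show "w i \<noteq> c *s u i" using TT[of "w i"] Tu[OF i, of c] w[OF i] by auto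
  qed
  have split: "a = 0 \<and> b = 0" if i: "i \<in> {1..s}" and eq: "a *s u i + b *s w i = 0" for a b i
  proof -
    have "a *s u i = (- b) *s w i" using eq by (simp add: eq_neg_iff_add_eq_0)
    then have "a *s u i = 0" using TT Tu[OF i, of a] Tw[OF i, of "- b"] by metis
    then show ?thesis using eq u(1)[OF i] w(1)[OF i] by simp
  qed
  have indep: "a = 0 \<and> b = 0 \<and> c = 0 \<and> d = 0"
    if ij: "i \<in> {1..s}" "j \<in> {1..s}" "i \<noteq> j" and eq: "a *s u i + b *s w i = c *s u j + d *s w j"
    for i j a b c d
  proof -
    have "a *s u i + b *s w i \<in> L i" "c *s u j + d *s w j \<in> L j"
      using line[OF ij(1)] line[OF ij(2)] by blast+
    then have "a *s u i + b *s w i = 0" "c *s u j + d *s w j = 0"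
      using zero[OF ij] eq by auto
    then show ?thesis using split[OF ij(1)] split[OF ij(2)] by blast
  qed
  have T1_iff: "a *s u i + b *s w i \<in> T1 \<longleftrightarrow> b = 0" if i: "i \<in> {1..s}" for a b i
  proof
    assume "a *s u i + b *s w i \<in> T1"
    from vec.subspace_diff[OF subT(1) this Tu[OF i, of a]] have "b *s w i \<in> T1" by simp
    then have "b *s w i = 0" using TT Tw[OF i] by blast
    then show "b = 0" using w(1)[OF i] by simp
  qed (simp add: Tu[OF i])
  have T2_iff: "a *s u i + b *s w i \<in> T2 \<longleftrightarrow> a = 0" if i: "i \<in> {1..s}" for a b i
  proof
    assume "a *s u i + b *s w i \<in> T2"
    from vec.subspace_diff[OF subT(2) this Tw[OF i, of b]] have "a *s u i \<in> T2" by simp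
    then have "a *s u i = 0" using TT Tu[OF i] by blast
    then show "a = 0" using u(1)[OF i] by simp
  qed (simp add: Tw[OF i])
  have I: "1 \<in> {1..s}" "2 \<in> {1..s}" "3 \<in> {1..s}" and I12: "(1 :: nat) \<noteq> 2" using s by auto
  have T1_eq: "T1 = {a *s u 1 + b *s u 2 | a b. True}"
  proof (rule proj_line_span[OF lineT(1) u(2)[OF I(1)] u(2)[OF I(2)] u(1)[OF I(1)]])
    fix c
    show "u 2 \<noteq> c *s u 1" using indep[OF I(2,1), of 1 0 c 0] by auto
  qed
  have T2_eq: "T2 = {a *s w 1 + b *s w 2 | a b. True}"
  proof (rule proj_line_span[OF lineT(2) w(2)[OF I(1)] w(2)[OF I(2)] w(1)[OF I(1)]])
    fix c
    show "w 2 \<noteq> c *s w 1" using indep[OF I(2,1), of 0 1 0 c] by auto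
  qed
  \<comment> \<open>The points of \<open>L 1\<close> and \<open>L 2\<close> on the transversals form
    a basis of K^4: regrouping a relation by line reduces it to skewness.\<close>
  have frame: "a = 0 \<and> b = 0 \<and> c = 0 \<and> d = 0"
    if "a *s u 1 + b *s u 2 + c *s w 1 + d *s w 2 = 0" for a b c d
  proof -
    have "a *s u 1 + c *s w 1 = (- b) *s u 2 + (- d) *s w 2"
      using that by (simp add: algebra_simps eq_neg_iff_add_eq_0)
    from indep[OF I(1,2) I12 this] show ?thesis by simp
  qed
  obtain E P :: "'a ^ 4 ^ 4" where PE: "P ** E = mat 1" and EP: "E ** P = mat 1"
    and E: "\<And>x. E *v x = x $ 1 *s u 1 + x $ 2 *s u 2 + x $ 3 *s w 1 + x $ 4 *s w 2"
    using frame_matrix[OF frame] by metis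
  have EP': "E *v (P *v v) = v" and PE': "P *v (E *v v) = v" for v
    by (simp_all add: matrix_vector_mul_assoc EP PE)
  have P: "P *v (a *s u 1 + b *s u 2 + c *s w 1 + d *s w 2) = quadvec a b c d" for a b c d
    using PE'[of "quadvec a b c d"] by (simp add: E)
  \<comment> \<open>(p, q) are the coordinates of \<open>u i\<close> on \<open>T1\<close>, and (r,
    t) those of \<open>w i\<close> on \<open>T2\<close>.\<close>
  define p q r t where "p i = (P *v u i) $ 1" and "q i = (P *v u i) $ 2"
    and "r i = (P *v w i) $ 3" and "t i = (P *v w i) $ 4" for i
  have Pu: "P *v u i = quadvec (p i) (q i) 0 0" if i: "i \<in> {1..s}" for i
  proof -
    obtain a b where "u i = a *s u 1 + b *s u 2" using u(2)[OF i] T1_eq by blast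
    then have "P *v u i = quadvec a b 0 0" using P[of a b 0 0] by simp
    then show ?thesis by (simp add: p_def q_def)
  qed
  have Pw: "P *v w i = quadvec 0 0 (r i) (t i)" if i: "i \<in> {1..s}" for i
  proof -
    obtain a b where "w i = a *s w 1 + b *s w 2" using w(2)[OF i] T2_eq by blast
    then have "P *v w i = quadvec 0 0 a b" using P[of 0 0 a b] by simp
    then show ?thesis by (simp add: r_def t_def)
  qed
  have uE: "u i = p i *s u 1 + q i *s u 2" if "i \<in> {1..s}" for i
    using EP'[of "u i"] Pu[OF that] by (simp add: E)
  have wE: "w i = r i *s w 1 + t i *s w 2" if "i \<in> {1..s}" for i
    using EP'[of "w i"] Pw[OF that] by (simp add: E)
  have base: "p 1 = 1" "q 1 = 0" "p 2 = 0" "q 2 = 1" "r 1 = 1" "t 1 = 0" "r 2 = 0" "t 2 = 1"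
    using P[of 1 0 0 0] P[of 0 1 0 0] P[of 0 0 1 0] P[of 0 0 0 1]
    by (simp_all add: p_def q_def r_def t_def)
  define A C where "A i j = p i * q j - q i * p j" and "C i j = r i * t j - t i * r j" for i j
  have A_nz: "A i j \<noteq> 0" if ij: "i \<in> {1..s}" "j \<in> {1..s}" "i \<noteq> j" for i j
  proof
    assume "A i j = 0"
    then have *: "p i * q j = q i * p j" by (simp add: A_def)
    \<comment> \<open>A zero determinant makes suitable multiples of \<open>u i\<close> and
      \<open>u j\<close> equal. Skewness first forces both second coordinates to vanish, then a
      second comparison kills \<open>p i\<close>, so \<open>u i\<close> would be 0.\<close>
    have "q j *s u i = (q j * p i) *s u 1 + (q j * q i) *s u 2"
      by (subst uE[OF ij(1)]) (simp add: vec.scale_right_distrib)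
    moreover have "q i *s u j = (q i * p j) *s u 1 + (q i * q j) *s u 2"
      by (subst uE[OF ij(2)]) (simp add: vec.scale_right_distrib)
    ultimately have "q j *s u i + 0 *s w i = q i *s u j + 0 *s w j"
      using * by (simp add: mult.commute)
    from indep[OF ij this] have q0: "q i = 0" "q j = 0" by auto
    have "p j *s u i = (p j * p i) *s u 1"
      by (subst uE[OF ij(1)]) (simp add: q0)
    moreover have "p i *s u j = (p i * p j) *s u 1"
      by (subst uE[OF ij(2)]) (simp add: q0)
    ultimately have "p j *s u i + 0 *s w i = p i *s u j + 0 *s w j"
      by (simp add: mult.commute)
    from indep[OF ij this] have "p i = 0" by auto
    then have "u i = 0" using uE[OF ij(1)] q0 by simp
    then show False using u(1)[OF ij(1)] by simp
  qed
  have C_nz: "C i j \<noteq> 0" if ij: "i \<in> {1..s}" "j \<in> {1..s}" "i \<noteq> j" for i j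
  proof
    assume "C i j = 0"
    then have *: "r i * t j = t i * r j" by (simp add: C_def)
    have "t j *s w i = (t j * r i) *s w 1 + (t j * t i) *s w 2"
      by (subst wE[OF ij(1)]) (simp add: vec.scale_right_distrib)
    moreover have "t i *s w j = (t i * r j) *s w 1 + (t i * t j) *s w 2"
      by (subst wE[OF ij(2)]) (simp add: vec.scale_right_distrib)
    ultimately have "0 *s u i + t j *s w i = 0 *s u j + t i *s w j"
      using * by (simp add: mult.commute)
    from indep[OF ij this] have t0: "t i = 0" "t j = 0" by auto
    have "r j *s w i = (r j * r i) *s w 1"
      by (subst wE[OF ij(1)]) (simp add: t0)
    moreover have "r i *s w j = (r i * r j) *s w 1"
      by (subst wE[OF ij(2)]) (simp add: t0)
    ultimately have "0 *s u i + r j *s w i = 0 *s u j + r i *s w j"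
      by (simp add: mult.commute)
    from indep[OF ij this] have "r i = 0" by auto
    then have "w i = 0" using wE[OF ij(1)] t0 by simp
    then show False using w(1)[OF ij(1)] by simp
  qed
  \<comment> \<open>The Pluecker relation between three vectors of a plane, used once on each
    transversal.\<close>
  have pluecker: "(pj * qk - qj * pk) *s (pi *s x + qi *s y)
    = (pi * qk - qi * pk) *s (pj *s x + qj *s y) + (pj * qi - qj * pi) *s (pk *s x + qk *s y)"
    for pi qi pj qj pk qk :: 'a and x y :: "'a ^ 4"
    by (simp add: vec_eq_iff algebra_simps)
  have A_pluecker: "A j k *s u i = A i k *s u j + A j i *s u k"
    if "i \<in> {1..s}" "j \<in> {1..s}" "k \<in> {1..s}" for i j k
    using pluecker[of "p j" "q k" "q j" "p k" "p i" "u 1" "q i" "u 2"]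
    unfolding A_def uE[OF that(1), symmetric] uE[OF that(2), symmetric] uE[OF that(3), symmetric] .
  have C_pluecker: "C j k *s w i = C i k *s w j + C j i *s w k"
    if "i \<in> {1..s}" "j \<in> {1..s}" "k \<in> {1..s}" for i j k
    using pluecker[of "r j" "t k" "t j" "r k" "r i" "w 1" "t i" "w 2"]
    unfolding C_def wE[OF that(1), symmetric] wE[OF that(2), symmetric] wE[OF that(3), symmetric] .
  have scaling: "\<exists>M :: 'a ^ 4 ^ 4. invertible M \<and> (\<forall>i\<in>{1..s}. M *v u i = u i \<and> M *v w i = c *s w i)"
    if c: "c \<noteq> 0" for c
  proof -
    \<comment> \<open>The diagonal matrix with entries 1, 1, x, x; conjugated by the frame it is the
      identity on \<open>T1\<close> and multiplication by x on \<open>T2\<close>.\<close>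
    define D :: "'a \<Rightarrow> 'a ^ 4 ^ 4"
      where "D x = (\<chi> i j. if i = j then if i = 1 \<or> i = 2 then 1 else x else 0)" for x
    have D: "D x *v quadvec a b e f = quadvec a b (x * e) (x * f)" for x a b e f
      by (simp add: D_def matrix_vector_mult_def quadvec_def vec_eq_iff forall_4 sum_4)
    have DD: "D x ** D y = mat 1" if "x * y = 1" for x y
      using that by (simp add: D_def matrix_matrix_mult_def mat_def vec_eq_iff forall_4 sum_4)
    have "invertible (D c)"
      unfolding invertible_def using DD[of c "1 / c"] DD[of "1 / c" c] c by auto
    moreover have "invertible E" "invertible P"
      unfolding invertible_def using EP PE by blast+
    ultimately have "invertible (E ** D c ** P)" by (intro invertible_mult)
    moreover have "(E ** D c ** P) *v v = E *v (D c *v (P *v v))" for v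
      by (simp add: matrix_vector_mul_assoc matrix_mul_assoc)
    moreover have "E *v (D c *v (P *v u i)) = u i" if "i \<in> {1..s}" for i
      unfolding Pu[OF that] D using EP'[of "u i"] Pu[OF that] by simp
    moreover have "E *v (D c *v (P *v w i)) = c *s w i" if "i \<in> {1..s}" for i
      unfolding Pw[OF that] D using wE[OF that] E[of "quadvec 0 0 (c * r i) (c * t i)"]
        arg_cong[OF wE[OF that], of "\<lambda>v. c *s v"] by (simp add: vec.scale_right_distrib)
    ultimately show ?thesis by (intro exI[of _ "E ** D c ** P"]) simp
  qed
  have nondegenerate: "\<exists>i j k l. {i, j, k, l} \<subseteq> {1..s} \<and> distinct [i, j, k, l] \<and>
      C i k / A i k * (C j l / A j l) \<noteq> C i l / A i l * (C j k / A j k)"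
  proof (rule ccontr)
    assume deg: "\<not> ?thesis"
    have deg': "C i k / A i k * (C j l / A j l) = C i l / A i l * (C j k / A j k)"
      if "{i, j, k, l} \<subseteq> {1..s}" "distinct [i, j, k, l]" for i j k l
      using deg that by blast
    have AC: "A 1 i = q i" "A 2 i = - p i" "C 1 i = t i" "C 2 i = - r i" for i
      unfolding A_def C_def base by simp_all
    have nz: "p i \<noteq> 0" "q i \<noteq> 0" "r i \<noteq> 0" "t i \<noteq> 0" if "i \<in> {1..s}" "i \<noteq> 1" "i \<noteq> 2" for i
      using A_nz[OF I(1) that(1)] A_nz[OF I(2) that(1)] C_nz[OF I(1) that(1)] C_nz[OF I(2) that(1)] that
      unfolding AC by auto
    note nz3 = nz[OF I(3)]
    \<comment> \<open>Chosen so that the third line lies on the quadric y1 y4 = c y2 y3;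
      \<open>L 1\<close> and \<open>L 2\<close> lie on it for every c.\<close>
    define c where "c = (p 3 * t 3) / (q 3 * r 3)"
    have c: "c \<noteq> 0" using nz3 by (simp add: c_def)
    have ruling: "p i * t i = c * q i * r i" if i: "i \<in> {1..s}" for i
    proof -
      consider "i = 1" | "i = 2" | "i = 3" | "i \<noteq> 1" "i \<noteq> 2" "i \<noteq> 3" by blast
      then show ?thesis
      proof cases
        case 4
        \<comment> \<open>By \<open>AC\<close> this equation says that p t / (q r) takes the same
          value at \<open>i\<close> and at 3, namely \<open>c\<close>.\<close>
        have "C 1 3 / A 1 3 * (C 2 i / A 2 i) = C 1 i / A 1 i * (C 2 3 / A 2 3)"
          by (rule deg') (use I i 4 in auto)
        then show ?thesis
          unfolding AC using nz3 nz[OF i 4(1,2)] by (simp add: c_def field_simps)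
      next
        case 1
        show ?thesis unfolding 1 base by simp
      next
        case 2
        show ?thesis unfolding 2 base by simp
      next
        case 3
        show ?thesis unfolding 3 c_def using nz3 by simp
      qed
    qed
    let ?Q = "\<chi> m n. P $ 1 $ m * P $ 4 $ n - c * P $ 2 $ m * P $ 3 $ n"
    have "smooth_quadric ?Q" by (rule smooth_hyperboloid[OF PE EP c])
    moreover have "pts (L i) \<subseteq> quadric_pts ?Q" if i: "i \<in> {1..s}" for i
    proof
      fix x assume x: "x \<in> pts (L i)"
      have "quad_form ?Q v = 0" if vx: "v \<in> x" for v
      proof -
        obtain a b where v: "v = a *s u i + b *s w i"
          using x vx line[OF i] unfolding pts_def by blast
        have "P *v v = a *s quadvec (p i) (q i) 0 0 + b *s quadvec 0 0 (r i) (t i)"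
          unfolding v by (simp add: matrix_vector_right_distrib vector_scalar_commute Pu[OF i] Pw[OF i])
        then have "quad_form ?Q v = a * b * (p i * t i - c * q i * r i)"
          unfolding quad_form_hyperboloid by (simp add: algebra_simps)
        then show ?thesis using ruling[OF i] by simp
      qed
      then show "x \<in> quadric_pts ?Q"
        using x unfolding quadric_pts_def pts_def by blast
    qed
    ultimately show False using nosmooth by blast
  qed
  have "two_transversals s L T1 T2 u w A C"
    by unfold_locales
      (fact s line indep T1_iff T2_iff subT A_nz C_nz A_pluecker C_pluecker scaling nondegenerate
       | simp add: A_def C_def)+
  then show ?thesis by blast
qed

theorem proposition2p1p16:
  fixes s :: nat
    and L :: "nat \<Rightarrow> ('a::field ^ 4) set"
    and T1 T2 :: "('a ^ 4) set"
  assumes "s \<ge> 4"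
    and "skew_lines s L"
    and "\<nexists>A. smooth_quadric A \<and> (\<forall>i\<in>{1..s}. pts (L i) \<subseteq> quadric_pts A)"
    and "transversal s L T1" and "transversal s L T2" and "T1 \<noteq> T2"
  shows
    "((\<forall>O'\<in>orbits s L.
        O' = pts T1 \<inter> all_pts s L \<or>
        O' = pts T2 \<inter> all_pts s L \<or>
        (\<exists>p\<in>all_pts s L - (pts T1 \<union> pts T2). O' = orbit s L p)) \<and>
     (\<forall>p\<in>all_pts s L - (pts T1 \<union> pts T2).
        infinite (orbit s L p) \<or> card (orbit s L p) > s) \<and>
     (\<forall>p\<in>all_pts s L - (pts T1 \<union> pts T2). \<forall>q\<in>all_pts s L - (pts T1 \<union> pts T2).
        proj_equivalent (orbit s L p) (orbit s L q))) \<and>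
     (\<forall>i\<in>{1..s}.
       (\<exists>H. subgroup H (mult_group TYPE('a)) \<and>
            vertex_group s L i \<cong> (mult_group TYPE('a))\<lparr>carrier := H\<rparr>) \<and>
       comm_group (vertex_group s L i) \<and>
       (\<forall>p\<in>pts (L i) - (pts T1 \<union> pts T2). \<forall>g\<in>carrier (vertex_group s L i).
          g p = p \<longrightarrow> g = \<one>\<^bsub>vertex_group s L i\<^esub>)) \<and>
     (\<forall>i\<in>{1..s}. \<forall>p\<in>pts (L i) - (pts T1 \<union> pts T2).
       finite (orbit s L p) \<longrightarrow>
       finite (carrier (vertex_group s L i)) \<and> cyclic_group (vertex_group s L i)) \<and>
     (\<forall>i\<in>{1..s}.
       generate (vertex_group s L i) (loops s L i) = carrier (vertex_group s L i) \<and>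
       (finite (carrier (vertex_group s L i)) \<longleftrightarrow>
        (\<forall>g\<in>loops s L i. \<exists>n::nat. n > 0 \<and>
           g [^]\<^bsub>vertex_group s L i\<^esub> n = \<one>\<^bsub>vertex_group s L i\<^esub>)))"
proof -
  obtain u w A C where "two_transversals s L T1 T2 u w A C"
    using two_transversals_frame[OF assms] by blast
  then interpret two_transversals s L T1 T2 u w A C .
  show ?thesis
    by (intro conjI ballI impI orbit_classification card_orbit_gt orbits_equivalent
        vertex_iso_subgroup comm_group_vertex vertex_faithful finite_orbit_imp_cyclic[THEN conjunct1]
        finite_orbit_imp_cyclic[THEN conjunct2] generate_loops finite_vertex_iff; assumption)
qed

end
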